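(* For every restricted frame graph $H$ that is also a $\ge 2$-subdivision of some multigraph, there is a set $\mathcal S$ of stable sets of $H$ such that the graph-stable set pair $(H,\mathcal S)$ is constructible.
   Context: A $\ge 2$-subdivision of a multigraph is obtained by replacing every edge by a path with at least $3$ edges. A frame is the boundary of an axis-parallel box in $\mathbb R^2$; a graph is a restricted frame graph if it is the intersection graph of a family of frames satisfying: (1) corners of a frame do not coincide with any point of another frame; (2) the left side of any frame meets no other frame; (3) if the right side of a frame meets a second frame, it meets both the top and bottom sides of that second frame; (4) if two frames intersect, no frame is entirely contained in the intersection of the regions bounded by these two frames. A graph-stable set pair $(G,\mathcal S)$ is a graph $G$ with a set $\mathcal S$ of stable sets of $G$. $(G,\mathcal S)$ is an induced subgraph-stable set pair of $(H,\mathcal S')$ if $G$ is an induced subgraph of $H$ and $\mathcal S\subseteq\{S'\cap V(G): S'\in\mathcal S'\}$. The operation NEXT maps $(G,\mathcal S)$ to $(G',\mathcal S')$ obtained by: keeping $G$; adding $|\mathcal S|$ disjoint copies $(H_S,\mathcal S(H_S))$ of $(G,\mathcal S)$, one for each $S\in\mathcal S$; for each $S\in\mathcal S$ and each $T\in\mathcal S(H_S)$ adding a new vertex $v_{S,T}$ whose neighborhood is exactly $T$; and setting $\mathcal S'=\{S\cup T: S\in\mathcal S, T\in\mathcal S(H_S)\}\cup\{S\cup\{v_{S,T}\}: S\in\mathcal S, T\in\mathcal S(H_S)\}$. A graph-stable set pair is constructible if it is an induced subgraph-stable set pair of $\mathrm{NEXT}^i(G_0,\mathcal S_0)$ for some $i\ge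 0$, where $G_0=K_1$ and $\mathcal S_0=\{V(G_0)\}$. *)

theory Defs
  imports Complex_Main "HOL-Library.FSet"
begin

definition graph :: "'a set \<Rightarrow> ('a \<times> 'a) set \<Rightarrow> bool" where
  "graph V E \<longleftrightarrow> E \<subseteq> V \<times> V \<and> (\<forall>u v. (u, v) \<in> E \<longrightarrow> (v, u) \<in> E) \<and> (\<forall>v. (v, v) \<notin> E)"

definition stable_set :: "'a set \<Rightarrow> ('a \<times> 'a) set \<Rightarrow> 'a set \<Rightarrow> bool" where
  "stable_set V E S \<longleftrightarrow> S \<subseteq> V \<and> (\<forall>u\<in>S. \<forall>v\<in>S. (u, v) \<notin> E)"

definition graph_iso :: "'a set \<Rightarrow> ('a \<times> 'a) set \<Rightarrow> 'b set \<Rightarrow> ('b \<times> 'b) set \<Rightarrow> ('a \<Rightarrow> 'b) \<Rightarrow> bool" where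
  "graph_iso V E V' E' f \<longleftrightarrow> bij_betw f V V' \<and> (\<forall>u\<in>V. \<forall>v\<in>V. (u, v) \<in> E \<longleftrightarrow> (f u, f v) \<in> E')"

text \<open>A frame (x1, x2, y1, y2) is the boundary of the box [x1,x2] x [y1,y2], x1 < x2, y1 < y2.\<close>

type_synonym frame = "real \<times> real \<times> real \<times> real"

definition valid_frame :: "frame \<Rightarrow> bool" where
  "valid_frame = (\<lambda>(x1, x2, y1, y2). x1 < x2 \<and> y1 < y2)"

definition left_side :: "frame \<Rightarrow> (real \<times> real) set" where
  "left_side = (\<lambda>(x1, x2, y1, y2). {p. fst p = x1 \<and> y1 \<le> snd p \<and> snd p \<le> y2})"

definition right_side :: "frame \<Rightarrow> (real \<times> real) set" where
  "right_side = (\<lambda>(x1, x2, y1, y2). {p. fst p = x2 \<and> y1 \<le> snd p \<and> snd p \<le> y2})"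

definition bottom_side :: "frame \<Rightarrow> (real \<times> real) set" where
  "bottom_side = (\<lambda>(x1, x2, y1, y2). {p. snd p = y1 \<and> x1 \<le> fst p \<and> fst p \<le> x2})"

definition top_side :: "frame \<Rightarrow> (real \<times> real) set" where
  "top_side = (\<lambda>(x1, x2, y1, y2). {p. snd p = y2 \<and> x1 \<le> fst p \<and> fst p \<le> x2})"

definition frame_points :: "frame \<Rightarrow> (real \<times> real) set" where
  "frame_points F = left_side F \<union> right_side F \<union> bottom_side F \<union> top_side F"

definition corners :: "frame \<Rightarrow> (real \<times> real) set" where
  "corners = (\<lambda>(x1, x2, y1, y2). {(x1, y1), (x1, y2), (x2, y1), (x2, y2)})"

definition region :: "frame \<Rightarrow> (real \<times> real) set" where
  "region = (\<lambda>(x1, x2, y1, y2). {p. x1 \<le> fst p \<and> fst p \<le> x2 \<and> y1 \<le> snd p \<and> snd p \<le> y2})"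

definition restricted_frame_graph :: "'a set \<Rightarrow> ('a \<times> 'a) set \<Rightarrow> bool" where
  "restricted_frame_graph V E \<longleftrightarrow>
    (\<exists>F :: 'a \<Rightarrow> frame.
       (\<forall>v\<in>V. valid_frame (F v)) \<and>
       (\<forall>u\<in>V. \<forall>v\<in>V. u \<noteq> v \<longrightarrow>
          ((u, v) \<in> E \<longleftrightarrow> frame_points (F u) \<inter> frame_points (F v) \<noteq> {})) \<and>
       \<comment> \<open>(1)\<close>
       (\<forall>u\<in>V. \<forall>v\<in>V. u \<noteq> v \<longrightarrow> corners (F u) \<inter> frame_points (F v) = {}) \<and>
       \<comment> \<open>(2)\<close>
       (\<forall>u\<in>V. \<forall>v\<in>V. u \<noteq> v \<longrightarrow> left_side (F u) \<inter> frame_points (F v) = {}) \<and>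
       \<comment> \<open>(3)\<close>
       (\<forall>u\<in>V. \<forall>v\<in>V. u \<noteq> v \<longrightarrow> right_side (F u) \<inter> frame_points (F v) \<noteq> {} \<longrightarrow>
          right_side (F u) \<inter> top_side (F v) \<noteq> {} \<and> right_side (F u) \<inter> bottom_side (F v) \<noteq> {}) \<and>
       \<comment> \<open>(4)\<close>
       (\<forall>u\<in>V. \<forall>v\<in>V. \<forall>w\<in>V. u \<noteq> v \<longrightarrow> frame_points (F u) \<inter> frame_points (F v) \<noteq> {} \<longrightarrow>
          \<not> frame_points (F w) \<subseteq> region (F u) \<inter> region (F v)))"

text \<open>A multigraph: finite vertex set VM, finite edge-name set EM, ends e = (a, b) with
a \<noteq> b both in VM (parallel edges allowed). Each edge e is replaced by a path with
len e \<ge> 3 edges; its internal vertices are Inr (e, i), 0 < i < len e.\<close>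

definition sd_vertex :: "(nat \<Rightarrow> nat \<times> nat) \<Rightarrow> (nat \<Rightarrow> nat) \<Rightarrow> nat \<Rightarrow> nat \<Rightarrow> nat + nat \<times> nat" where
  "sd_vertex ends len e i =
     (if i = 0 then Inl (fst (ends e)) else if i = len e then Inl (snd (ends e)) else Inr (e, i))"

definition sd_V :: "nat set \<Rightarrow> nat set \<Rightarrow> (nat \<Rightarrow> nat) \<Rightarrow> (nat + nat \<times> nat) set" where
  "sd_V VM EM len = Inl ` VM \<union> {Inr (e, i) | e i. e \<in> EM \<and> 0 < i \<and> i < len e}"

definition sd_E :: "nat set \<Rightarrow> (nat \<Rightarrow> nat \<times> nat) \<Rightarrow> (nat \<Rightarrow> nat) \<Rightarrow> ((nat + nat \<times> nat) \<times> (nat + nat \<times> nat)) set" where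
  "sd_E EM ends len =
     {(sd_vertex ends len e i, sd_vertex ends len e (Suc i)) | e i. e \<in> EM \<and> i < len e} \<union>
     {(sd_vertex ends len e (Suc i), sd_vertex ends len e i) | e i. e \<in> EM \<and> i < len e}"

definition ge2_subdivision :: "'a set \<Rightarrow> ('a \<times> 'a) set \<Rightarrow> bool" where
  "ge2_subdivision V E \<longleftrightarrow>
    (\<exists>VM EM ends len f. finite VM \<and> finite EM \<and>
       (\<forall>e\<in>EM. fst (ends e) \<in> VM \<and> snd (ends e) \<in> VM \<and> fst (ends e) \<noteq> snd (ends e) \<and> len e \<ge> 3) \<and>
       graph_iso V E (sd_V VM EM len) (sd_E EM ends len) f)"

datatype vtx = Root | Orig vtx | Cp "vtx fset" vtx | Nw "vtx fset" "vtx fset"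

type_synonym gsp = "vtx set \<times> (vtx \<times> vtx) set \<times> vtx set set"

text \<open>NEXT: the original graph is kept (renamed by Orig); the copy H_S is renamed by Cp S;
the vertex v_{S,T} is Nw S T (T indexing the stable set Cp S ` T of H_S).\<close>

definition NEXT :: "gsp \<Rightarrow> gsp" where
  "NEXT G = (case G of (V, E, SS) \<Rightarrow>
     (Orig ` V \<union> (\<Union>S\<in>SS. Cp (Abs_fset S) ` V)
        \<union> {Nw (Abs_fset S) (Abs_fset T) | S T. S \<in> SS \<and> T \<in> SS},
      {(Orig u, Orig v) | u v. (u, v) \<in> E}
        \<union> {(Cp (Abs_fset S) u, Cp (Abs_fset S) v) | S u v. S \<in> SS \<and> (u, v) \<in> E}
        \<union> {(Nw (Abs_fset S) (Abs_fset T), Cp (Abs_fset S) t) | S T t. S \<in> SS \<and> T \<in> SS \<and> t \<in> T}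
        \<union> {(Cp (Abs_fset S) t, Nw (Abs_fset S) (Abs_fset T)) | S T t. S \<in> SS \<and> T \<in> SS \<and> t \<in> T},
      {Orig ` S \<union> Cp (Abs_fset S) ` T | S T. S \<in> SS \<and> T \<in> SS}
        \<union> {Orig ` S \<union> {Nw (Abs_fset S) (Abs_fset T)} | S T. S \<in> SS \<and> T \<in> SS}))"

definition G0 :: gsp where
  "G0 = ({Root}, {}, {{Root}})"

definition induced_sub_pair ::
  "'a set \<Rightarrow> ('a \<times> 'a) set \<Rightarrow> 'a set set \<Rightarrow> gsp \<Rightarrow> bool" where
  "induced_sub_pair V E SS G' \<longleftrightarrow> (case G' of (V', E', SS') \<Rightarrow>
     (\<exists>f. inj_on f V \<and> f ` V \<subseteq> V' \<and>
          (\<forall>u\<in>V. \<forall>v\<in>V. (u, v) \<in> E \<longleftrightarrow> (f u, f v) \<in> E') \<and>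
          (\<forall>S\<in>SS. \<exists>S'\<in>SS'. S = {v \<in> V. f v \<in> S'})))"

definition constructible :: "'a set \<Rightarrow> ('a \<times> 'a) set \<Rightarrow> 'a set set \<Rightarrow> bool" where
  "constructible V E SS \<longleftrightarrow> (\<exists>i. induced_sub_pair V E SS ((NEXT ^^ i) G0))"

end

(*
  Two frames of a restricted representation that intersect do so in one way only: the left side
  of one, v, lies inside the other, u, and v leaves u through the right side of u ("v enters u").
  Write A v for the frames around v and Out v for the frames v enters, and call v regular if
  A v and Out v together form a down-closed chain (a branch) for containment. If every vertex is
  regular, the graph is built by NEXT: take the outermost frame r whose left side is rightmost.
  No other frame enters r or anything inside r, so what lies outside r and what lies inside r can
  be constructed separately, r being the new vertex attached to the branch Out r.

  If v is not regular, then, the graph having no triangle or square, v enters exactly one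
  frame u, and the frame p immediately around v enters u too. Such irregularities are removed one
  by one. If u has degree 2, make u enter v and p instead. Otherwise u is a branch vertex of the
  subdivision, so p and the neighbours of p have degree at most 2. If the cluster of frames that
  hang on v inside p touches the outside only at u, move it out of p. If not, some t of degree 2
  enters p and that cluster, u is a cut vertex, and p, t and their contents can be
  moved to the innermost frame entered by u, so that u enters p and v instead.
*)
theory Submission
  imports Defs
begin

section \<open>Models of frame arrangements\<close>

lemma finite_has_max_image:
  fixes f :: "'b \<Rightarrow> real"
  assumes "finite S" "S \<noteq> {}"
  obtains x where "x \<in> S" "\<And>y. y \<in> S \<Longrightarrow> f y \<le> f x"
proof -
  have "Max (f ` S) \<in> f ` S" using assms by simp
  then obtain x where "x \<in> S" "Max (f ` S) = f x" by blast
  moreover from this have "f y \<le> f x" if "y \<in> S" for y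
    using Max_ge[of "f ` S" "f y"] assms that by simp
  ultimately show ?thesis using that by blast
qed

definition branch :: "('a \<Rightarrow> 'a set) \<Rightarrow> 'a set \<Rightarrow> bool" where
  "branch A C \<longleftrightarrow> (\<forall>c\<in>C. A c \<subseteq> C) \<and> (\<forall>c\<in>C. \<forall>d\<in>C. c = d \<or> c \<in> A d \<or> d \<in> A c)"

definition regular :: "('a \<Rightarrow> 'a set) \<Rightarrow> ('a \<Rightarrow> 'a set) \<Rightarrow> 'a \<Rightarrow> bool" where
  "regular A Out v \<longleftrightarrow> branch A (Out v \<union> A v) \<and> Out v \<inter> A v = {}"

text \<open>For frames without triangles and squares in their intersection graph this is the only
  way to fail regularity. The predicate does not exclude regularity: with \<open>A v = A u\<close>
  both can hold, so later lemmas assume non-regularity separately.\<close>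

definition irregular :: "('a \<Rightarrow> 'a set) \<Rightarrow> ('a \<Rightarrow> 'a set) \<Rightarrow> 'a \<Rightarrow> 'a \<Rightarrow> bool" where
  "irregular A Out v u \<longleftrightarrow> Out v = {u} \<and> A u \<subseteq> A v \<and> (\<forall>q\<in>A v - A u. u \<in> Out q)"

text \<open>\<open>A v\<close> stands for the frames strictly around \<open>v\<close>, \<open>Out v\<close> for the frames that \<open>v\<close> enters, and
  \<open>rk v\<close> for the abscissa of its left side.\<close>

locale weak_model =
  fixes V :: "'a set" and E :: "('a \<times> 'a) set" and A Out :: "'a \<Rightarrow> 'a set" and rk :: "'a \<Rightarrow> real"
  assumes fin: "finite V"
    and A_sub: "v \<in> V \<Longrightarrow> A v \<subseteq> V"
    and Out_sub: "v \<in> V \<Longrightarrow> Out v \<subseteq> V"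
    and A_rk: "v \<in> V \<Longrightarrow> a \<in> A v \<Longrightarrow> rk a < rk v"
    and Out_rk: "v \<in> V \<Longrightarrow> a \<in> Out v \<Longrightarrow> rk a < rk v"
    and A_trans: "v \<in> V \<Longrightarrow> a \<in> A v \<Longrightarrow> A a \<subseteq> A v"
    and A_chain: "v \<in> V \<Longrightarrow> a \<in> A v \<Longrightarrow> b \<in> A v \<Longrightarrow> a = b \<or> a \<in> A b \<or> b \<in> A a"
    and E_iff: "u \<in> V \<Longrightarrow> v \<in> V \<Longrightarrow> (u, v) \<in> E \<longleftrightarrow> u \<in> Out v \<or> v \<in> Out u"
    and weak: "v \<in> V \<Longrightarrow> regular A Out v \<or> (\<exists>u. irregular A Out v u)"

section \<open>From frames to models\<close>

text \<open>A left side that misses the other frame either misses its whole box or lies in the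
  interior of that box. Applied to both left sides, this leaves the listed positions; the corner
  condition then excludes aligned right sides.\<close>

lemma box_cases:
  fixes l1 r1 b1 t1 l2 r2 b2 t2 :: real
  assumes "l1 < r1" "b1 < t1" "l2 < r2" "b2 < t2"
    and L1: "left_side (l1, r1, b1, t1) \<inter> frame_points (l2, r2, b2, t2) = {}"
    and L2: "left_side (l2, r2, b2, t2) \<inter> frame_points (l1, r1, b1, t1) = {}"
    and C1: "corners (l1, r1, b1, t1) \<inter> frame_points (l2, r2, b2, t2) = {}"
    and C2: "corners (l2, r2, b2, t2) \<inter> frame_points (l1, r1, b1, t1) = {}"
  shows "r1 < l2 \<or> r2 < l1 \<or> t1 < b2 \<or> t2 < b1 \<or>
    (l1 < l2 \<and> l2 < r1 \<and> b1 < b2 \<and> t2 < t1 \<and> (r1 < r2 \<or> r2 < r1)) \<or>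
    (l2 < l1 \<and> l1 < r2 \<and> b2 < b1 \<and> t1 < t2 \<and> (r1 < r2 \<or> r2 < r1))"
proof -
  have vseg: "l < l' \<or> r' < l \<or> t < b' \<or> t' < b \<or> (l' < l \<and> l < r' \<and> b' < b \<and> t < t')"
    if "left_side (l, r, b, t) \<inter> frame_points (l', r', b', t') = {}" "b < t" "b' < t'" "l' < r'"
    for l r b t l' r' b' t' :: real
  proof (rule ccontr)
    assume neg: "\<not> ?thesis"
    have pt: "\<not> (b \<le> y \<and> y \<le> t \<and> (l = l' \<and> b' \<le> y \<and> y \<le> t' \<or> l = r' \<and> b' \<le> y \<and> y \<le> t' \<or>
       (y = b' \<or> y = t') \<and> l' \<le> l \<and> l \<le> r'))" for y
    proof
      assume "b \<le> y \<and> y \<le> t \<and> (l = l' \<and> b' \<le> y \<and> y \<le> t' \<or> l = r' \<and> b' \<le> y \<and> y \<le> t' \<or>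
       (y = b' \<or> y = t') \<and> l' \<le> l \<and> l \<le> r')"
      hence "(l, y) \<in> left_side (l, r, b, t) \<inter> frame_points (l', r', b', t')"
        by (auto simp: left_side_def right_side_def top_side_def bottom_side_def frame_points_def)
      with that(1) show False by blast
    qed
    have n: "l' \<le> l" "l \<le> r'" "b' \<le> t" "b \<le> t'" "\<not> (l' < l \<and> l < r' \<and> b' < b \<and> t < t')"
      using neg by linarith+
    show False
    proof (cases "l = l' \<or> l = r'")
      case True
      \<comment> \<open>Two overlapping segments on one vertical line share the point of ordinate
        \<open>max b b'\<close>. Off the vertical sides, the segment would cross the level
        \<open>b'\<close> or \<open>t'\<close>.\<close>
      thus False using pt[of "max b b'"] n that(2-4) by (simp add: max_def split: if_splits)
    next
      case False
      hence "b \<le> b' \<or> t' \<le> t" using n by linarith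
      thus False using pt[of b'] pt[of t'] n that(2-4) by linarith
    qed
  qed
  \<comment> \<open>If the right sides were aligned, the upper right corner of the box with the
    lower top would lie on the other frame.\<close>
  have ne: "r1 \<noteq> r2" if "b1 \<le> t2" "t2 \<le> t1"
  proof
    assume "r1 = r2"
    hence "(r2, t2) \<in> corners (l2, r2, b2, t2) \<inter> frame_points (l1, r1, b1, t1)"
      using that by (auto simp: corners_def right_side_def frame_points_def)
    thus False using C2 by blast
  qed
  have ne': "r1 \<noteq> r2" if "b2 \<le> t1" "t1 \<le> t2"
  proof
    assume "r1 = r2"
    hence "(r1, t1) \<in> corners (l1, r1, b1, t1) \<inter> frame_points (l2, r2, b2, t2)"
      using that by (auto simp: corners_def right_side_def frame_points_def)
    thus False using C1 by blast
  qed
  show ?thesis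
  proof (rule ccontr)
    assume neg: "\<not> ?thesis"
    hence n: "l2 \<le> r1" "l1 \<le> r2" "b2 \<le> t1" "b1 \<le> t2" by linarith+
    have 1: "l1 < l2 \<or> (l2 < l1 \<and> l1 < r2 \<and> b2 < b1 \<and> t1 < t2)"
      using vseg[OF L1] assms(1-4) n by linarith
    have 2: "l2 < l1 \<or> (l1 < l2 \<and> l2 < r1 \<and> b1 < b2 \<and> t2 < t1)"
      using vseg[OF L2] assms(1-4) n by linarith
    from 1 show False
    proof
      assume "l1 < l2"
      hence "l2 < r1" "b1 < b2" "t2 < t1" using 2 by linarith+
      moreover from this have "r1 \<noteq> r2" using ne n by linarith
      ultimately show False using neg \<open>l1 < l2\<close> by linarith
    next
      assume a: "l2 < l1 \<and> l1 < r2 \<and> b2 < b1 \<and> t1 < t2"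
      hence "r1 \<noteq> r2" using ne' n by linarith
      thus False using neg a by linarith
    qed
  qed
qed

section \<open>Mutual position of two frames\<close>

definition inside :: "frame \<Rightarrow> frame \<Rightarrow> bool" where
  "inside = (\<lambda>(l, r, b, t) (l', r', b', t'). l' < l \<and> r < r' \<and> b' < b \<and> t < t')"

definition enters :: "frame \<Rightarrow> frame \<Rightarrow> bool" where
  "enters = (\<lambda>(l, r, b, t) (l', r', b', t'). l' < l \<and> l < r' \<and> r' < r \<and> b' < b \<and> t < t')"

definition apart :: "frame \<Rightarrow> frame \<Rightarrow> bool" where
  "apart = (\<lambda>(l, r, b, t) (l', r', b', t'). r < l' \<or> r' < l \<or> t < b' \<or> t' < b)"

lemma frame_cases:
  assumes "valid_frame F" "valid_frame G"
    and "left_side F \<inter> frame_points G = {}" "left_side G \<inter> frame_points F = {}"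
    and "corners F \<inter> frame_points G = {}" "corners G \<inter> frame_points F = {}"
  shows "apart F G \<or> inside F G \<or> inside G F \<or> enters F G \<or> enters G F"
proof -
  obtain l1 r1 b1 t1 l2 r2 b2 t2 where FG: "F = (l1, r1, b1, t1)" "G = (l2, r2, b2, t2)"
    by (metis prod_cases4)
  show ?thesis
    using box_cases[of l1 r1 b1 t1 l2 r2 b2 t2] assms
    unfolding FG apart_def inside_def enters_def valid_frame_def by auto
qed

lemma mem_frame_points:
  assumes "valid_frame (l, r, b, t)"
  shows "p \<in> frame_points (l, r, b, t) \<longleftrightarrow> l \<le> fst p \<and> fst p \<le> r \<and> b \<le> snd p \<and> snd p \<le> t \<and>
    (fst p = l \<or> fst p = r \<or> snd p = b \<or> snd p = t)"
  using assms by (auto simp: valid_frame_def left_side_def right_side_def bottom_side_def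
      top_side_def frame_points_def)

lemma enters_meet:
  assumes "valid_frame F" "valid_frame G" "enters F G"
  shows "frame_points F \<inter> frame_points G \<noteq> {}"
proof -
  obtain l1 r1 b1 t1 l2 r2 b2 t2 where FG: "F = (l1, r1, b1, t1)" "G = (l2, r2, b2, t2)"
    by (metis prod_cases4)
  \<comment> \<open>This is where the top side of \<open>F\<close> crosses the right side of
    \<open>G\<close>.\<close>
  have "(r2, t1) \<in> frame_points F" "(r2, t1) \<in> frame_points G"
    using assms unfolding FG by (auto simp: mem_frame_points) (auto simp: enters_def valid_frame_def)
  thus ?thesis by blast
qed

lemma not_meet:
  assumes "valid_frame F" "valid_frame G" "apart F G \<or> inside F G \<or> inside G F"
  shows "frame_points F \<inter> frame_points G = {}"
proof -
  obtain l1 r1 b1 t1 l2 r2 b2 t2 where FG: "F = (l1, r1, b1, t1)" "G = (l2, r2, b2, t2)"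
    by (metis prod_cases4)
  have False if "p \<in> frame_points F" "p \<in> frame_points G" for p
  proof -
    have p: "l1 \<le> fst p" "fst p \<le> r1" "b1 \<le> snd p" "snd p \<le> t1"
      "fst p = l1 \<or> fst p = r1 \<or> snd p = b1 \<or> snd p = t1"
      "l2 \<le> fst p" "fst p \<le> r2" "b2 \<le> snd p" "snd p \<le> t2"
      "fst p = l2 \<or> fst p = r2 \<or> snd p = b2 \<or> snd p = t2"
      using that assms(1,2) unfolding FG by (simp_all add: mem_frame_points)
    show False
      using assms(3) unfolding FG apart_def inside_def prod.case
      using p by linarith
  qed
  thus ?thesis by blast
qed

lemma inside_region:
  assumes "valid_frame F" "inside F G"
  shows "frame_points F \<subseteq> region G"
proof -
  obtain l1 r1 b1 t1 l2 r2 b2 t2 where FG: "F = (l1, r1, b1, t1)" "G = (l2, r2, b2, t2)"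
    by (metis prod_cases4)
  show ?thesis
    using assms unfolding FG by (auto simp: mem_frame_points inside_def region_def)
qed

text \<open>Left abscissae serve as ranks. The frames around \<open>v\<close> all contain
  \<open>v\<close>, and those that \<open>v\<close> enters all contain its left side, so two frames
  of the same family are adjacent or nested; condition (4), respectively the absence of triangles,
  excludes adjacency. Only the interplay of the two families can break regularity, and the absence
  of squares then leads to \<open>irregular\<close>.\<close>

lemma frames_weak_model:
  assumes fin: "finite V" and gr: "graph V E" and rf: "restricted_frame_graph V E"
    and C3: "\<And>a b c. (a, b) \<in> E \<Longrightarrow> (b, c) \<in> E \<Longrightarrow> (c, a) \<in> E \<Longrightarrow> False"
    and C4: "\<And>a b c d. (a, b) \<in> E \<Longrightarrow> (b, c) \<in> E \<Longrightarrow> (c, d) \<in> E \<Longrightarrow> (d, a) \<in> E \<Longrightarrow> a \<noteq> c \<Longrightarrow> b \<noteq> d \<Longrightarrow> False"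
  shows "\<exists>A Out rk. weak_model V E A Out rk"
proof -
  obtain F :: "'a \<Rightarrow> frame" where
    val': "\<forall>v\<in>V. valid_frame (F v)"
    and adj': "\<forall>u\<in>V. \<forall>v\<in>V. u \<noteq> v \<longrightarrow>
          ((u, v) \<in> E \<longleftrightarrow> frame_points (F u) \<inter> frame_points (F v) \<noteq> {})"
    and cor': "\<forall>u\<in>V. \<forall>v\<in>V. u \<noteq> v \<longrightarrow> corners (F u) \<inter> frame_points (F v) = {}"
    and lef': "\<forall>u\<in>V. \<forall>v\<in>V. u \<noteq> v \<longrightarrow> left_side (F u) \<inter> frame_points (F v) = {}"
    and emp': "\<forall>u\<in>V. \<forall>v\<in>V. \<forall>w\<in>V. u \<noteq> v \<longrightarrow> frame_points (F u) \<inter> frame_points (F v) \<noteq> {} \<longrightarrow>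
          \<not> frame_points (F w) \<subseteq> region (F u) \<inter> region (F v)"
    using rf unfolding restricted_frame_graph_def by (elim exE conjE) (rule that, assumption+)
  note val = val'[rule_format] and adj = adj'[rule_format] and cor = cor'[rule_format]
    and lef = lef'[rule_format] and emp = emp'[rule_format]
  define l r b t where "l v = fst (F v)" and "r v = fst (snd (F v))"
    and "b v = fst (snd (snd (F v)))" and "t v = snd (snd (snd (F v)))" for v
  hence F: "F v = (l v, r v, b v, t v)" for v by simp
  note sd = inside_def enters_def apart_def F
  have lr: "l v < r v" "b v < t v" if "v \<in> V" for v
    using val[OF that] by (auto simp: valid_frame_def F)
  let ?I = "\<lambda>v a. inside (F v) (F a)" and ?N = "\<lambda>v u. enters (F v) (F u)"
  have cases: "apart (F u) (F v) \<or> ?I u v \<or> ?I v u \<or> ?N u v \<or> ?N v u" if "u \<in> V" "v \<in> V" "u \<noteq> v" for u v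
    by (rule frame_cases) (use that val lef cor in auto)
  have E_iff: "(u, v) \<in> E \<longleftrightarrow> ?N u v \<or> ?N v u" if "u \<in> V" "v \<in> V" for u v
  proof (cases "u = v")
    case True
    thus ?thesis using gr by (auto simp: graph_def sd)
  next
    case False
    show ?thesis
      using cases[OF that False] adj[OF that False] enters_meet[of "F u" "F v"] enters_meet[of "F v" "F u"]
        not_meet[of "F u" "F v"] val that by blast
  qed
  have no_between: False if "u \<in> V" "v \<in> V" "w \<in> V" "(u, v) \<in> E" "?I w u" "?I w v" for u v w
  proof -
    have "u \<noteq> v" using that(4) gr by (auto simp: graph_def)
    thus False using emp[of u v w] adj[of u v] inside_region val that by blast
  qed
  have sym: "(u, v) \<in> E \<Longrightarrow> (v, u) \<in> E" for u v using gr by (auto simp: graph_def)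
  define A where "A v = {a \<in> V. ?I v a}" for v
  define Out where "Out v = {u \<in> V. ?N v u}" for v
  have nested: "?I a c \<or> ?I c a" if "a \<in> V" "c \<in> V" "a \<noteq> c" "(a, c) \<notin> E" "\<not> apart (F a) (F c)" for a c
    using cases[OF that(1-3)] E_iff[OF that(1,2)] that(4,5) by blast
  have chain: "a = c \<or> a \<in> A c \<or> c \<in> A a" if "v \<in> V" "a \<in> A v" "c \<in> A v" for v a c
  proof (cases "a = c")
    case False
    have "a \<in> V" "c \<in> V" "?I v a" "?I v c" using that by (auto simp: A_def)
    moreover have "\<not> apart (F a) (F c)" using calculation lr[OF that(1)] by (auto simp: sd)
    moreover have "(a, c) \<notin> E" using no_between calculation that(1) by blast
    ultimately show ?thesis using nested[of a c] False by (auto simp: A_def)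
  qed simp
  have Out_chain: "a = c \<or> a \<in> A c \<or> c \<in> A a" if "v \<in> V" "a \<in> Out v" "c \<in> Out v" for v a c
  proof (cases "a = c")
    case False
    have m: "a \<in> V" "c \<in> V" "?N v a" "?N v c" using that by (auto simp: Out_def)
    moreover have "\<not> apart (F a) (F c)" using m lr[OF that(1)] by (auto simp: sd)
    moreover have "(a, c) \<notin> E" using C3[of v a c] m E_iff that(1) by blast
    ultimately show ?thesis using nested[of a c] False by (auto simp: A_def)
  qed simp
  \<comment> \<open>Being around \<open>v\<close>, the frame \<open>a\<close> reaches beyond the
    right side of \<open>u\<close>; so it is not inside \<open>u\<close>, and \<open>u\<close> does
    not enter it.\<close>
  have mixed: "a \<in> A u \<or> u \<in> Out a" if "v \<in> V" "a \<in> A v" "u \<in> Out v" for v a u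
  proof -
    have m: "a \<in> V" "u \<in> V" "?I v a" "?N v u" using that by (auto simp: A_def Out_def)
    have "a \<noteq> u" using m lr[OF that(1)] by (auto simp: sd)
    thus ?thesis using cases[of a u] m lr[OF that(1)] by (auto simp: sd A_def Out_def)
  qed
  \<comment> \<open>A frame around a frame entered by \<open>v\<close> contains the left side of
    \<open>v\<close>.\<close>
  have clos: "e \<in> A v \<union> Out v" if "v \<in> V" "c \<in> Out v" "e \<in> A c" for v c e
  proof -
    have m: "c \<in> V" "e \<in> V" "?N v c" "?I c e" using that by (auto simp: A_def Out_def)
    have "e \<noteq> v" using m by (auto simp: sd)
    thus ?thesis using cases[of e v] m that(1) lr[OF that(1)] by (auto simp: sd A_def Out_def)
  qed
  have trans: "A a \<subseteq> A v" if "a \<in> A v" for a v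
    using that by (auto simp: A_def sd)
  have "weak_model V E A Out l"
  proof
    fix v assume v: "v \<in> V"
    show "regular A Out v \<or> (\<exists>u. irregular A Out v u)"
    proof (cases "\<forall>a\<in>A v. \<forall>u\<in>Out v. u \<notin> Out a")
      case True
      have "branch A (Out v \<union> A v)"
        unfolding branch_def using True mixed[OF v] chain[OF v] Out_chain[OF v] clos[OF v] trans by blast
      moreover have "Out v \<inter> A v = {}" by (auto simp: A_def Out_def sd)
      ultimately show ?thesis by (simp add: regular_def)
    next
      case False
      then obtain a u where au: "a \<in> A v" "u \<in> Out v" "u \<in> Out a" by blast
      have m: "a \<in> V" "u \<in> V" "?I v a" "?N v u" "?N a u" using au by (auto simp: A_def Out_def)
      have av: "a \<noteq> v" using m by (auto simp: sd)
      have "w = u" if w: "w \<in> Out v" for w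
      proof (rule ccontr)
        assume wu: "w \<noteq> u"
        have mw: "w \<in> V" "?N v w" using w by (auto simp: Out_def)
        \<comment> \<open>Otherwise \<open>a\<close>, \<open>u\<close>, \<open>v\<close>,
          \<open>w\<close> form a square. Hence \<open>a\<close> is around \<open>w\<close>, and
          either \<open>w\<close> lies inside the two adjacent frames \<open>a\<close> and
          \<open>u\<close>, against condition (4), or \<open>a\<close> is around \<open>u\<close>,
          which it enters.\<close>
        have "w \<notin> Out a"
          using C4[of a u v w] m mw wu av E_iff v by (auto simp: Out_def)
        hence "a \<in> A w" using mixed[OF v au(1) w] by blast
        hence wa: "?I w a" by (auto simp: A_def)
        have "u \<in> A w \<or> w \<in> A u" using Out_chain[OF v w au(2)] wu by blast
        thus False
        proof
          assume "u \<in> A w"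
          thus False using no_between[of a u w] m mw wa E_iff by (auto simp: A_def)
        next
          assume "w \<in> A u"
          thus False using wa m by (auto simp: A_def sd)
        qed
      qed
      hence Ov: "Out v = {u}" using au(2) by blast
      have "A u \<subseteq> A v"
      proof
        fix e assume e: "e \<in> A u"
        hence "e \<noteq> u" by (auto simp: A_def sd)
        thus "e \<in> A v" using clos[OF v au(2) e] Ov by blast
      qed
      moreover have "\<forall>q\<in>A v - A u. u \<in> Out q" using mixed[OF v _ au(2)] by blast
      ultimately show ?thesis using Ov by (auto simp: irregular_def)
    qed
  qed (use fin chain trans E_iff in \<open>auto simp: A_def Out_def sd\<close>)
  thus ?thesis by blast
qed

section \<open>Subdivisions\<close>

lemma sd_E_sym: "(x, y) \<in> sd_E EM ends len \<Longrightarrow> (y, x) \<in> sd_E EM ends len"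
  by (auto simp: sd_E_def)

lemma sd_E_Inl:
  assumes "\<And>e. e \<in> EM \<Longrightarrow> len e \<ge> 3" "(Inl a, y) \<in> sd_E EM ends len"
  obtains e i where "e \<in> EM" "y = Inr (e, i)"
    "i = 1 \<and> a = fst (ends e) \<or> i = len e - 1 \<and> a = snd (ends e)"
proof -
  from assms(2) obtain e i where e: "e \<in> EM" "i < len e" and
    "sd_vertex ends len e i = Inl a \<and> y = sd_vertex ends len e (Suc i) \<or>
     sd_vertex ends len e (Suc i) = Inl a \<and> y = sd_vertex ends len e i"
    unfolding sd_E_def by auto
  thus thesis using that[OF e(1)] assms(1)[OF e(1)]
    by (auto simp: sd_vertex_def split: if_splits)
qed

lemma sd_E_Inr_Inr:
  shows "(Inr (e, i), Inr (e', j)) \<in> sd_E EM ends len \<Longrightarrow> e = e' \<and> (j = Suc i \<or> i = Suc j)"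
  by (auto simp: sd_E_def sd_vertex_def split: if_splits)

lemma sd_E_Inr:
  assumes "(Inr (e, i), y) \<in> sd_E EM ends len"
  shows "y = sd_vertex ends len e (i - 1) \<or> y = sd_vertex ends len e (Suc i)"
  using assms by (auto simp: sd_E_def sd_vertex_def split: if_splits)


text \<open>The other two vertices of a triangle through an original vertex would be consecutive on
  one path; but as the ends of a path differ, only one internal vertex of that path is adjacent to a
  given end. A triangle of internal vertices would need three integers pairwise at distance
  one.\<close>

lemma sd_E_no_triangle:
  assumes len: "\<And>e. e \<in> EM \<Longrightarrow> len e \<ge> 3"
    and ends: "\<And>e. e \<in> EM \<Longrightarrow> fst (ends e) \<noteq> snd (ends e)"
    and E: "(a, b) \<in> sd_E EM ends len" "(b, c) \<in> sd_E EM ends len" "(c, a) \<in> sd_E EM ends len"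
  shows False
proof -
  have Inl: False if h: "(Inl x, p) \<in> sd_E EM ends len" "(p, q) \<in> sd_E EM ends len"
      "(q, Inl x) \<in> sd_E EM ends len" for x p q
  proof -
    obtain e i where p: "e \<in> EM" "p = Inr (e, i)"
      "i = 1 \<and> x = fst (ends e) \<or> i = len e - 1 \<and> x = snd (ends e)"
      using sd_E_Inl[OF len h(1)] by metis
    obtain e' j where q: "q = Inr (e', j)"
      "j = 1 \<and> x = fst (ends e') \<or> j = len e' - 1 \<and> x = snd (ends e')"
      using sd_E_Inl[OF len sd_E_sym[OF h(3)]] by metis
    have "e = e' \<and> (j = Suc i \<or> i = Suc j)" using sd_E_Inr_Inr h(2) p(2) q(1) by blast
    thus False using p(3) q(2) ends[OF p(1)] by auto
  qed
  show False
  proof (cases "\<exists>x. a = Inl x \<or> b = Inl x \<or> c = Inl x")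
    case True
    thus ?thesis using Inl E by blast
  next
    case False
    then obtain e i e' j e'' k where v: "a = Inr (e, i)" "b = Inr (e', j)" "c = Inr (e'', k)"
      by (cases a; cases b; cases c) auto
    show ?thesis using E[unfolded v, THEN sd_E_Inr_Inr] by auto
  qed
qed

text \<open>Positions \<open>1\<close> and \<open>len e - 1\<close> of a path are distinct, since it
  has at least three edges.\<close>

lemma sd_E_Inl_unique:
  assumes len: "\<And>e. e \<in> EM \<Longrightarrow> len e \<ge> 3"
    and E: "(x, Inl b) \<in> sd_E EM ends len" "(x, Inl c) \<in> sd_E EM ends len"
  shows "b = c"
proof -
  obtain e i where p: "e \<in> EM" "x = Inr (e, i)"
    "i = 1 \<and> b = fst (ends e) \<or> i = len e - 1 \<and> b = snd (ends e)"
    using sd_E_Inl[OF len sd_E_sym[OF E(1)]] by metis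
  obtain e' j where q: "x = Inr (e', j)"
    "j = 1 \<and> c = fst (ends e') \<or> j = len e' - 1 \<and> c = snd (ends e')"
    using sd_E_Inl[OF len sd_E_sym[OF E(2)]] by metis
  show ?thesis using p q len[OF p(1)] by auto
qed

text \<open>In a square through an original vertex, the opposite vertex is internal by
  \<open>sd_E_Inl_unique\<close>; so the other three vertices lie on one path, and its only internal
  vertex next to the given end would occur twice. Among internal vertices, two opposite ones differ
  by two in position and have a single common neighbour.\<close>

lemma sd_E_no_square:
  assumes len: "\<And>e. e \<in> EM \<Longrightarrow> len e \<ge> 3"
    and ends: "\<And>e. e \<in> EM \<Longrightarrow> fst (ends e) \<noteq> snd (ends e)"
    and E: "(a, b) \<in> sd_E EM ends len" "(b, c) \<in> sd_E EM ends len" "(c, d) \<in> sd_E EM ends len"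
      "(d, a) \<in> sd_E EM ends len"
    and ne: "a \<noteq> c" "b \<noteq> d"
  shows False
proof -
  have Inl: False if h: "(Inl x, p) \<in> sd_E EM ends len" "(p, q) \<in> sd_E EM ends len"
      "(q, s) \<in> sd_E EM ends len" "(s, Inl x) \<in> sd_E EM ends len" "Inl x \<noteq> q" "p \<noteq> s"
    for x p q s
  proof -
    obtain e i where p: "e \<in> EM" "p = Inr (e, i)"
      "i = 1 \<and> x = fst (ends e) \<or> i = len e - 1 \<and> x = snd (ends e)"
      using sd_E_Inl[OF len h(1)] by metis
    obtain e' j where s: "s = Inr (e', j)"
      "j = 1 \<and> x = fst (ends e') \<or> j = len e' - 1 \<and> x = snd (ends e')"
      using sd_E_Inl[OF len sd_E_sym[OF h(4)]] by metis
    have "q \<noteq> Inl y" for y using h(2,5) sd_E_Inl_unique[OF len sd_E_sym[OF h(1)], of y] by blast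
    then obtain e'' k where q: "q = Inr (e'', k)" by (cases q) auto
    have "e = e'' \<and> (k = Suc i \<or> i = Suc k)" using sd_E_Inr_Inr h(2) p(2) q by blast
    moreover have "e'' = e' \<and> (j = Suc k \<or> k = Suc j)" using sd_E_Inr_Inr h(3) s(1) q by blast
    ultimately show False using p s h(6) ends[OF p(1)] by auto
  qed
  show False
  proof (cases "\<exists>x. a = Inl x \<or> b = Inl x \<or> c = Inl x \<or> d = Inl x")
    case True
    then consider x where "a = Inl x" | x where "b = Inl x" | x where "c = Inl x" | x where "d = Inl x"
      by blast
    thus ?thesis
    proof cases
      case 1 thus ?thesis using Inl[of _ b c d] E ne by blast
    next
      case 2 thus ?thesis using Inl[of _ c d a] E ne by blast
    next
      case 3 thus ?thesis using Inl[of _ d a b] E ne by blast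
    next
      case 4 thus ?thesis using Inl[of _ a b c] E ne by blast
    qed
  next
    case False
    then obtain e i e' j e'' k e3 l where
      v: "a = Inr (e, i)" "b = Inr (e', j)" "c = Inr (e'', k)" "d = Inr (e3, l)"
      by (cases a; cases b; cases c; cases d) auto
    show ?thesis using E[unfolded v, THEN sd_E_Inr_Inr] ne unfolding v by auto
  qed
qed

lemma sd_E_degree:
  assumes "(Inr v, b) \<in> sd_E EM ends len" "(Inr v, c) \<in> sd_E EM ends len"
    "(Inr v, d) \<in> sd_E EM ends len" "b \<noteq> c"
  shows "d = b \<or> d = c"
proof -
  obtain e i where v: "v = (e, i)" by (cases v)
  show ?thesis using assms(1-3)[unfolded v, THEN sd_E_Inr] assms(4) by auto
qed

text \<open>\<open>B\<close> is the set of branch vertices. The rest of the argument uses the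
  subdivision only through these five properties.\<close>

lemma ge2_subdivision_sparse:
  assumes gr: "graph V E" and sub: "ge2_subdivision V E"
  obtains B where "\<And>b c. b \<in> B \<Longrightarrow> c \<in> B \<Longrightarrow> (b, c) \<notin> E"
    "\<And>x b c. x \<in> V \<Longrightarrow> b \<in> B \<Longrightarrow> c \<in> B \<Longrightarrow> (x, b) \<in> E \<Longrightarrow> (x, c) \<in> E \<Longrightarrow> b = c"
    "\<And>x b c d. x \<in> V - B \<Longrightarrow> (x, b) \<in> E \<Longrightarrow> (x, c) \<in> E \<Longrightarrow> (x, d) \<in> E \<Longrightarrow> b \<noteq> c \<Longrightarrow> d = b \<or> d = c"
    "\<And>a b c. (a, b) \<in> E \<Longrightarrow> (b, c) \<in> E \<Longrightarrow> (c, a) \<in> E \<Longrightarrow> False"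
    "\<And>a b c d. (a, b) \<in> E \<Longrightarrow> (b, c) \<in> E \<Longrightarrow> (c, d) \<in> E \<Longrightarrow> (d, a) \<in> E \<Longrightarrow> a \<noteq> c \<Longrightarrow> b \<noteq> d \<Longrightarrow> False"
proof -
  obtain VM EM ends len f where
    M: "\<forall>e\<in>EM. fst (ends e) \<in> VM \<and> snd (ends e) \<in> VM \<and> fst (ends e) \<noteq> snd (ends e) \<and> len e \<ge> 3"
    and iso: "graph_iso V E (sd_V VM EM len) (sd_E EM ends len) f"
    using sub unfolding ge2_subdivision_def by blast
  let ?F = "sd_E EM ends len"
  have len: "len e \<ge> 3" and ends: "fst (ends e) \<noteq> snd (ends e)" if "e \<in> EM" for e using M that by auto
  have EV: "u \<in> V" "v \<in> V" if "(u, v) \<in> E" for u v using gr that by (auto simp: graph_def)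
  have inj: "inj_on f V" using iso by (simp add: graph_iso_def bij_betw_def)
  have F: "(f u, f v) \<in> ?F" if "(u, v) \<in> E" for u v
    using iso EV[OF that] that by (simp add: graph_iso_def)
  have eq: "u = v" if "f u = f v" "u \<in> V" "v \<in> V" for u v using inj that by (simp add: inj_on_def)
  show thesis
  proof (rule that[of "{v \<in> V. \<exists>x. f v = Inl x}"])
    show "(b, c) \<notin> E" if "b \<in> {v \<in> V. \<exists>x. f v = Inl x}" "c \<in> {v \<in> V. \<exists>x. f v = Inl x}" for b c
    proof
      assume "(b, c) \<in> E"
      moreover from that obtain x y where "f b = Inl x" "f c = Inl y" by blast
      ultimately have "(Inl x, Inl y) \<in> ?F" using F[of b c] by simp
      from sd_E_Inl[OF len this] show False by blast
    qed
    show "b = c" if "x \<in> V" "b \<in> {v \<in> V. \<exists>x. f v = Inl x}" "c \<in> {v \<in> V. \<exists>x. f v = Inl x}"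
      "(x, b) \<in> E" "(x, c) \<in> E" for x b c
    proof -
      from that obtain y z where yz: "f b = Inl y" "f c = Inl z" by blast
      from sd_E_Inl_unique[OF len F[OF that(4), unfolded yz] F[OF that(5), unfolded yz]]
      have "y = z" .
      thus ?thesis using eq[of b c] yz that by simp
    qed
    show "d = b \<or> d = c" if x: "x \<in> V - {v \<in> V. \<exists>x. f v = Inl x}" "(x, b) \<in> E" "(x, c) \<in> E" "(x, d) \<in> E"
      "b \<noteq> c" for x b c d
    proof -
      obtain y where y: "f x = Inr y" using x(1) by (cases "f x") auto
      have "f b \<noteq> f c" using eq x EV by blast
      hence "f d = f b \<or> f d = f c" using sd_E_degree F[OF x(2)] F[OF x(3)] F[OF x(4)] unfolding y by blast
      thus ?thesis using eq x EV by blast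
    qed
    show False if "(a, b) \<in> E" "(b, c) \<in> E" "(c, a) \<in> E" for a b c
      using sd_E_no_triangle[OF len ends F[OF that(1)] F[OF that(2)] F[OF that(3)]] .
    show False if "(a, b) \<in> E" "(b, c) \<in> E" "(c, d) \<in> E" "(d, a) \<in> E" "a \<noteq> c" "b \<noteq> d" for a b c d
      using sd_E_no_square[OF len ends F[OF that(1)] F[OF that(2)] F[OF that(3)] F[OF that(4)]]
        eq[of a c] eq[of b d] that EV by blast
  qed
qed

section \<open>Removing irregular vertices\<close>

text \<open>The measure of the repair process: each move replaces this set by a proper
  subset.\<close>

definition irregulars :: "'a set \<Rightarrow> ('a \<Rightarrow> 'a set) \<Rightarrow> ('a \<Rightarrow> 'a set) \<Rightarrow> 'a set" where
  "irregulars V A Out = {v \<in> V. \<not> regular A Out v}"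

section \<open>Consequences of the axioms, and the three moves\<close>

context weak_model
begin

lemma A_irrefl: "v \<in> V \<Longrightarrow> v \<notin> A v" using A_rk by blast
lemma A_asym: "v \<in> V \<Longrightarrow> a \<in> A v \<Longrightarrow> v \<notin> A a" using A_trans A_irrefl by blast

lemma branch_A: "v \<in> V \<Longrightarrow> branch A (A v)"
  unfolding branch_def using A_trans A_chain by blast

text \<open>For irregular \<open>v\<close> with \<open>u\<close> around it, the last clause of
  \<open>irregular\<close> could be applied to \<open>u\<close> itself and would make
  \<open>u\<close> enter itself.\<close>

lemma A_Out_disj:
  assumes "v \<in> V" shows "A v \<inter> Out v = {}"
proof (cases "regular A Out v")
  case False
  then obtain u where u: "irregular A Out v u" using weak assms by blast
  show ?thesis
  proof (rule ccontr)
    assume "A v \<inter> Out v \<noteq> {}"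
    hence uA: "u \<in> A v" using u by (auto simp: irregular_def)
    hence "u \<in> V" using A_sub assms by blast
    hence "u \<notin> A u" using A_irrefl by blast
    hence "u \<in> Out u" using u uA by (auto simp: irregular_def)
    thus False using Out_rk \<open>u \<in> V\<close> by blast
  qed
qed (auto simp: regular_def)

lemma branch_stable:
  assumes C: "C \<subseteq> V" "branch A C" shows "stable_set V E C"
  unfolding stable_set_def
proof (intro conjI ballI C(1))
  fix u v assume "u \<in> C" "v \<in> C"
  hence uv: "u \<in> V" "v \<in> V" and cmp: "u = v \<or> u \<in> A v \<or> v \<in> A u" using C by (auto simp: branch_def)
  have "u \<notin> Out v" if "u \<in> V" "v \<in> V" "u = v \<or> u \<in> A v \<or> v \<in> A u" for u v
    using that A_Out_disj[of v] Out_rk[of v u] A_rk[of u v] by auto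
  thus "(u, v) \<notin> E" using E_iff[OF uv] uv cmp by blast
qed

text \<open>In the chain \<open>A v\<close> the innermost frame is the one of greatest rank.\<close>

lemma parent_exists:
  assumes "v \<in> V" "A v \<noteq> {}"
  obtains p where "p \<in> A v" "A v = insert p (A p)"
proof -
  have f: "finite (A v)" using A_sub[OF assms(1)] fin finite_subset by blast
  obtain p where p: "p \<in> A v" and pmax: "\<And>q. q \<in> A v \<Longrightarrow> rk q \<le> rk p"
    using finite_has_max_image[OF f assms(2), of rk] by blast
  have "q \<in> insert p (A p)" if "q \<in> A v" for q
    using A_chain[OF assms(1) that p] pmax[OF that] A_rk[of q p] A_sub[OF assms(1)] that by fastforce
  thus ?thesis using that p A_trans[OF assms(1) p] by blast
qed

text \<open>If \<open>A v = A u\<close>, then \<open>u\<close> with the frames around it would be a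
  branch and \<open>v\<close> regular. So some frame around \<open>v\<close> is not around
  \<open>u\<close>; the innermost one then is not either, and hence enters \<open>u\<close>.\<close>

lemma irregular_parent:
  assumes "v \<in> V" "\<not> regular A Out v" "irregular A Out v u"
  obtains p where "p \<in> A v" "A v = insert p (A p)" "u \<in> Out p" "A u \<subseteq> A p" "p \<notin> A u"
proof -
  have uV: "u \<in> V" using assms Out_sub by (auto simp: irregular_def)
  have "A v \<noteq> A u"
  proof
    assume eq: "A v = A u"
    have "branch A ({u} \<union> A u)"
      using branch_A[OF uV] by (auto simp: branch_def)
    hence "regular A Out v" using assms eq A_irrefl[OF uV] by (auto simp: regular_def irregular_def)
    thus False using assms by blast
  qed
  hence ne: "A v \<noteq> {}" using assms by (auto simp: irregular_def)
  obtain p where p: "p \<in> A v" "A v = insert p (A p)" using parent_exists[OF assms(1) ne] .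
  have pV: "p \<in> V" using p A_sub assms(1) by blast
  have "p \<notin> A u" using \<open>A v \<noteq> A u\<close> p assms(3) A_trans[OF uV] by (auto simp: irregular_def)
  thus ?thesis using that p assms(3) by (auto simp: irregular_def)
qed

text \<open>Without \<open>u\<close>, the vertex \<open>v\<close> enters nothing and is regular. As
  \<open>p\<close> is the parent of \<open>v\<close>, the frames \<open>p\<close>, \<open>v\<close>
  and those around \<open>p\<close> form a branch, so \<open>u\<close> can be made to enter its two
  neighbours.\<close>

lemma move_target:
  assumes v: "v \<in> V" "\<not> regular A Out v" "irregular A Out v u"
    and p: "p \<in> A v" "A v = insert p (A p)" "u \<in> Out p"
    and N: "\<And>x. x \<in> V \<Longrightarrow> (u, x) \<in> E \<Longrightarrow> x = p \<or> x = v"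
  shows "\<exists>A' Out' rk'. weak_model V E A' Out' rk' \<and> irregulars V A' Out' \<subset> irregulars V A Out"
proof -
  have pV: "p \<in> V" using p A_sub v by blast
  have uV: "u \<in> V" using p pV Out_sub by blast
  have Ov: "Out v = {u}" using v by (auto simp: irregular_def)
  have up: "rk u < rk p" "rk p < rk v" using Out_rk[OF pV p(3)] A_rk[OF v(1) p(1)] .
  have ne: "u \<noteq> p" "u \<noteq> v" "p \<noteq> v" using up by auto
  \<comment> \<open>Both neighbours of \<open>u\<close> start to the right of it, while a frame only
    enters frames that start further left.\<close>
  have Ou: "Out u = {}"
  proof (rule ccontr)
    assume "Out u \<noteq> {}"
    then obtain x where x: "x \<in> Out u" by blast
    hence "x \<in> V" "rk x < rk u" using Out_sub Out_rk uV by auto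
    thus False using N[of x] E_iff[of u x] x uV up by fastforce
  qed
  have In: "u \<in> Out x \<longleftrightarrow> x = p \<or> x = v" if "x \<in> V" for x
    using N[OF that] E_iff[OF uV that] p(3) Ov by blast
  have uAp: "u \<notin> A p" using A_Out_disj[OF pV] p(3) by blast
  \<comment> \<open>Delete \<open>u\<close> and reinsert it, with nothing inside, to the right of everything it must meet.\<close>
  define A' where "A' x = (if x = u then A v \<inter> A p else A x - {u})" for x
  define Out' where "Out' x = (if x = u then {p, v} else Out x - {u})" for x
  define rk' where "rk' x = (if x = u then rk v + 1 else rk x)" for x
  have Au: "A' u = A p" using p(2) by (auto simp: A'_def)
  have A'_eq: "A' x = A x - {u}" if "x \<noteq> u" for x using that by (simp add: A'_def)
  have Ap: "A' p = A p" using A'_eq ne uAp by auto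
  have Av: "A' v = insert p (A p)" using A'_eq ne uAp p(2) by auto
  have br: "branch A' (C - {u})" if "branch A C" for C
    using that unfolding branch_def using A'_eq by auto
  have reg: "regular A' Out' x" if "x \<in> V" "x \<noteq> u" "regular A Out x" for x
    using br[of "Out x \<union> A x"] that A'_eq[of x] unfolding regular_def
    by (auto simp: Out'_def Un_Diff)
  have regv: "regular A' Out' v"
    using br[OF branch_A[OF v(1)]] A'_eq[of v] ne Ov by (auto simp: regular_def Out'_def)
  have regu: "regular A' Out' u"
  proof -
    have "branch A (A v)" using branch_A v by blast
    hence "branch A' (A v)" using br[of "A v"] uAp ne p(2) by (metis Diff_empty Diff_insert0 insert_iff)
    have "{p, v} \<union> A p = insert v (A v)" using p by auto
    moreover have "branch A' (insert v (A v))"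
      using \<open>branch A' (A v)\<close> Av p(2) unfolding branch_def by auto
    moreover have "{p, v} \<inter> A p = {}" using A_irrefl pV A_asym v(1) p(1) by auto
    ultimately show ?thesis using Au by (auto simp: regular_def Out'_def)
  qed
  have "weak_model V E A' Out' rk'"
  proof
    show "finite V" by (rule fin)
  next
    fix x assume x: "x \<in> V"
    show "A' x \<subseteq> V" using A_sub x pV by (auto simp: A'_def)
    show "Out' x \<subseteq> V" using Out_sub x pV v(1) by (auto simp: Out'_def)
    show "regular A' Out' x \<or> (\<exists>w. irregular A' Out' x w)"
    proof (cases "x = u \<or> x = v \<or> regular A Out x")
      case True
      thus ?thesis using reg[OF x] regu regv by blast
    next
      case False
      then obtain w where w: "irregular A Out x w" using weak x by blast
      show ?thesis
      proof (cases "w = u")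
        case True
        \<comment> \<open>Having lost its only target, \<open>x\<close> enters nothing, and the
          frames around it form a branch by themselves.\<close>
        have "branch A' (A x - {u})" using br[OF branch_A[OF x]] .
        moreover have "Out' x = {}" using w True False by (auto simp: irregular_def Out'_def)
        ultimately have "regular A' Out' x" using A'_eq[of x] False by (auto simp: regular_def)
        thus ?thesis by blast
      next
        case wu: False
        have "irregular A' Out' x w"
          using w wu False A'_eq[of x] A'_eq[of w] by (auto simp: irregular_def Out'_def)
        thus ?thesis by blast
      qed
    qed
    {
      fix a assume a: "a \<in> A' x"
      show "rk' a < rk' x"
      proof (cases "x = u")
        case True
        hence "rk a < rk p" "a \<noteq> u" using a Au A_rk[OF pV, of a] uAp by auto
        thus ?thesis using True up by (simp add: rk'_def)
      next
        case False
        thus ?thesis using a A_rk[OF x] A'_eq by (auto simp: rk'_def)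
      qed
      show "A' a \<subseteq> A' x"
      proof (cases "x = u")
        case True
        hence "a \<in> A p" "a \<noteq> u" using a Au uAp by auto
        thus ?thesis using True A_trans[OF pV] Au A'_eq by auto
      next
        case False
        thus ?thesis using a A_trans[OF x] A'_eq by (metis Diff_iff Diff_mono insertCI subset_refl)
      qed
      fix b assume b: "b \<in> A' x"
      show "a = b \<or> a \<in> A' b \<or> b \<in> A' a"
      proof (cases "x = u")
        case True
        hence "a \<in> A p" "a \<noteq> u" "b \<in> A p" "b \<noteq> u" using a b Au uAp by auto
        thus ?thesis using A_chain[OF pV] A'_eq by auto
      next
        case False
        thus ?thesis using a b A_chain[OF x] A'_eq by auto
      qed
    }
    {
      fix a assume a: "a \<in> Out' x"
      show "rk' a < rk' x"
        using a Out_rk[OF x] up ne by (auto simp: rk'_def Out'_def split: if_splits)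
    }
    fix y assume y: "y \<in> V"
    show "(x, y) \<in> E \<longleftrightarrow> x \<in> Out' y \<or> y \<in> Out' x"
      using E_iff[OF x y] In[OF x] In[OF y] Ou ne by (auto simp: Out'_def)
  qed
  moreover have "irregulars V A' Out' \<subseteq> irregulars V A Out"
    using reg regu by (auto simp: irregulars_def)
  moreover have "v \<in> irregulars V A Out" "v \<notin> irregulars V A' Out'"
    using v regv by (auto simp: irregulars_def)
  ultimately show ?thesis by blast
qed

text \<open>Only the edge between \<open>v\<close> and \<open>u\<close> leaves \<open>X\<close>, so
  \<open>X\<close> can change its surrounding frames while \<open>Out\<close> and \<open>rk\<close>
  stay as they are. Afterwards the frames around \<open>v\<close> are exactly those around
  \<open>u\<close>, and \<open>v\<close> is regular.\<close>

lemma move_component: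
  assumes v: "v \<in> V" "\<not> regular A Out v" "irregular A Out v u"
    and p: "p \<in> A v" "A v = insert p (A p)"
    and X: "X \<subseteq> V" "v \<in> X" "\<And>x. x \<in> X \<Longrightarrow> p \<in> A x"
    and Xup: "\<And>x. x \<in> X \<Longrightarrow> A x - A v \<subseteq> X"
    and Xdown: "\<And>x y. x \<in> X \<Longrightarrow> y \<in> V \<Longrightarrow> x \<in> A y \<Longrightarrow> y \<in> X"
    and Xedge: "\<And>x y. x \<in> X \<Longrightarrow> y \<in> V - X \<Longrightarrow> (x, y) \<in> E \<Longrightarrow> x = v \<and> y = u"
  shows "\<exists>A' Out' rk'. weak_model V E A' Out' rk' \<and> irregulars V A' Out' \<subset> irregulars V A Out"
proof -
  have pV: "p \<in> V" using p A_sub v by blast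
  have Ov: "Out v = {u}" and AuAv: "A u \<subseteq> A v" using v by (auto simp: irregular_def)
  have uV: "u \<in> V" using Ov v Out_sub by blast
  have AvX: "A v \<inter> X = {}"
  proof (rule ccontr)
    assume "A v \<inter> X \<noteq> {}"
    then obtain x where x: "x \<in> A v" "x \<in> X" by blast
    hence "p \<in> A x" using X(3) by blast
    hence "x \<noteq> p" "x \<notin> A p" using A_irrefl pV A_asym by blast+
    thus False using x p(2) by blast
  qed
  \<comment> \<open>With \<open>u\<close> inside \<open>p\<close>, the sets \<open>A u\<close> and
    \<open>A v\<close> would coincide and \<open>v\<close> would be regular.\<close>
  have uX: "u \<notin> X"
  proof
    assume "u \<in> X" hence "p \<in> A u" using X(3) by blast
    hence "A v \<subseteq> A u" using p A_trans[OF uV] by auto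
    hence "A u = A v" using AuAv by blast
    moreover have "branch A ({u} \<union> A u)" using branch_A[OF uV] by (auto simp: branch_def)
    ultimately have "regular A Out v" using Ov A_irrefl[OF uV] by (auto simp: regular_def)
    thus False using v by blast
  qed
  \<comment> \<open>Pull \<open>X\<close> out of the frames around \<open>v\<close> that do not contain \<open>u\<close>.\<close>
  define B where "B = A v - A u"
  have BX: "B \<inter> X = {}" using AvX by (auto simp: B_def)
  define A' where "A' x = (if x \<in> X then A x - B else A x)" for x
  have outside: "A x \<inter> X = {}" if "x \<in> V - X" for x using Xdown that by blast
  have base: "a \<in> A u" if "x \<in> X" "a \<in> A x - B" "a \<notin> X" for x a
    using Xup[OF that(1)] that(2,3) by (auto simp: B_def)
  have A'_sub: "A' x \<subseteq> A x" for x by (auto simp: A'_def)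
  have A'_tr: "A' a \<subseteq> A' x" if x: "x \<in> V" and a: "a \<in> A' x" for x a
  proof (cases "x \<in> X")
    case True
    have aA: "a \<in> A x - B" using a True by (simp add: A'_def)
    show ?thesis
    proof (cases "a \<in> X")
      case True
      thus ?thesis using \<open>x \<in> X\<close> A_trans[OF x, of a] aA by (auto simp: A'_def)
    next
      case False
      hence "a \<in> A u" using base[OF True aA] by blast
      hence "A a \<subseteq> A u" using A_trans uV by blast
      thus ?thesis using False True A_trans[OF x, of a] aA by (auto simp: A'_def B_def)
    qed
  next
    case False
    hence "a \<in> A x" "a \<notin> X" using a outside[of x] x by (auto simp: A'_def)
    thus ?thesis using False A_trans[OF x] by (simp add: A'_def)
  qed
  have A'_ch: "a = b \<or> a \<in> A' b \<or> b \<in> A' a" if x: "x \<in> V" and a: "a \<in> A' x" and b: "b \<in> A' x" for x a b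
    using A_chain[OF x, of a b] a b A'_sub[of x] unfolding A'_def
    by (smt (verit) Diff_iff Xdown outside A_sub disjoint_iff subsetD x)
  \<comment> \<open>The only edge that crosses the boundary of \<open>X\<close> is directed
    outwards, \<open>v\<close> entering \<open>u\<close>.\<close>
  have Out_X: "Out x \<inter> X = {}" if "x \<in> V - X" for x
  proof (rule ccontr)
    assume "Out x \<inter> X \<noteq> {}"
    then obtain y where y: "y \<in> Out x" "y \<in> X" by blast
    hence "(y, x) \<in> E" using E_iff that X(1) by blast
    hence "y = v" "x = u" using Xedge y that by blast+
    thus False using y Ov Out_rk[OF v(1), of u] Out_rk[OF uV, of v] by simp
  qed
  have X_Out: "Out x \<subseteq> X" if "x \<in> X" "x \<noteq> v" for x
  proof
    fix y assume y: "y \<in> Out x"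
    hence "y \<in> V" "(x, y) \<in> E" using E_iff Out_sub that X(1) by blast+
    thus "y \<in> X" using Xedge[OF that(1), of y] that(2) by blast
  qed
  have reg: "regular A' Out x" if x: "x \<in> V" "regular A Out x" for x
  proof (cases "x \<in> X")
    case False
    have "(Out x \<union> A x) \<inter> X = {}" using Out_X outside False x by blast
    thus ?thesis using x(2) False unfolding regular_def branch_def A'_def by (auto; blast)
  next
    case True
    have "x \<noteq> v" using x v by blast
    hence O: "Out x \<subseteq> X" using X_Out True by blast
    have b: "branch A (Out x \<union> A x)" "Out x \<inter> A x = {}" using x by (auto simp: regular_def)
    \<comment> \<open>The new set is the old branch with \<open>B\<close> removed, since
      \<open>Out x\<close> lies in \<open>X\<close> and \<open>B\<close> outside.\<close>
    have eq: "Out x \<union> A' x = (Out x \<union> A x) - B" using O BX True by (auto simp: A'_def)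
    have "branch A' (Out x \<union> A' x)"
      unfolding branch_def
    proof (intro conjI ballI)
      fix c assume c: "c \<in> Out x \<union> A' x"
      show "A' c \<subseteq> Out x \<union> A' x"
      proof (cases "c \<in> Out x")
        case True
        hence "A' c = A c - B" using O by (auto simp: A'_def)
        thus ?thesis using b(1) True eq unfolding branch_def by blast
      next
        case False
        thus ?thesis using c A'_tr x(1) by blast
      qed
      fix d assume d: "d \<in> Out x \<union> A' x"
      have "c = d \<or> c \<in> A d \<or> d \<in> A c" using b(1) c d eq unfolding branch_def by blast
      thus "c = d \<or> c \<in> A' d \<or> d \<in> A' c" using c d eq by (auto simp: A'_def)
    qed
    moreover have "Out x \<inter> A' x = {}" using b(2) A'_sub by blast
    ultimately show ?thesis by (simp add: regular_def)
  qed
  have regv: "regular A' Out v"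
  proof -
    have "A' v = A u" using AuAv X(2) by (auto simp: A'_def B_def)
    moreover have "A u \<inter> X = {}" using outside uX uV by blast
    hence "branch A' ({u} \<union> A u)"
      using branch_A[OF uV] uX unfolding branch_def A'_def by (auto; blast)
    ultimately show ?thesis using Ov A_irrefl[OF uV] by (auto simp: regular_def)
  qed
  have "weak_model V E A' Out rk"
  proof
    fix x assume x: "x \<in> V"
    show "regular A' Out x \<or> (\<exists>w. irregular A' Out x w)"
    proof (cases "x = v \<or> regular A Out x")
      case True
      thus ?thesis using reg[OF x] regv by blast
    next
      case False
      then obtain w where w: "irregular A Out x w" using weak x by blast
      \<comment> \<open>An irregular vertex other than \<open>v\<close> lies on the same side of
        \<open>X\<close> as its target, so both lose \<open>B\<close> or neither does, and
        \<open>irregular\<close> persists.\<close>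
      have "x \<in> X \<longleftrightarrow> w \<in> X" using w False X_Out[of x] Out_X[of x] x by (auto simp: irregular_def)
      hence "irregular A' Out x w" using w by (auto simp: irregular_def A'_def)
      thus ?thesis by blast
    qed
    show "A' x \<subseteq> V" using A_sub[OF x] A'_sub by blast
    show "Out x \<subseteq> V" using Out_sub[OF x] .
    fix a
    show "rk a < rk x" if "a \<in> A' x" using A_rk[OF x] A'_sub that by blast
    show "rk a < rk x" if "a \<in> Out x" using Out_rk[OF x that] .
    show "A' a \<subseteq> A' x" if "a \<in> A' x" using A'_tr[OF x that] .
    show "a = b \<or> a \<in> A' b \<or> b \<in> A' a" if "a \<in> A' x" "b \<in> A' x" for b using A'_ch[OF x that] .
    show "(x, y) \<in> E \<longleftrightarrow> x \<in> Out y \<or> y \<in> Out x" if "y \<in> V" for y using E_iff[OF x that] .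
  qed (rule fin)
  moreover have "irregulars V A' Out \<subseteq> irregulars V A Out"
    using reg by (auto simp: irregulars_def)
  moreover have "v \<in> irregulars V A Out" "v \<notin> irregulars V A' Out"
    using v regv by (auto simp: irregulars_def)
  ultimately show ?thesis by blast
qed

text \<open>The frames \<open>p\<close>, \<open>t\<close> and their contents meet the rest only at
  \<open>u\<close>, which \<open>p\<close> and \<open>a\<close> enter. Since \<open>u\<close> is
  regular, \<open>A u\<close> and \<open>Out u\<close> together form a branch; once these contents
  lie inside it, adding \<open>p\<close> and \<open>a\<close> yields a longer branch, so the two
  edges can be reversed. Uniqueness of \<open>a\<close> and maximality of \<open>u\<close> ensure
  that nothing else in the moved part is irregular.\<close>

lemma move_across_cutvertex:
  assumes a: "a \<in> V" "\<not> regular A Out a" "irregular A Out a u"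
    and p: "p \<in> A a" "A a = insert p (A p)" "u \<in> Out p"
    and u_reg: "regular A Out u"
    and u_max: "\<And>x w. x \<in> V \<Longrightarrow> \<not> regular A Out x \<Longrightarrow> irregular A Out x w \<Longrightarrow> rk w \<le> rk u"
    and uniq: "\<And>x. x \<in> V \<Longrightarrow> p \<in> A x \<Longrightarrow> \<not> regular A Out x \<Longrightarrow> x = a"
    and t: "t \<in> V" "Out t = {p, z}" "A t = A p"
    and z: "A z = insert p (A p)"
    and Np: "\<And>x. x \<in> V \<Longrightarrow> (p, x) \<in> E \<Longrightarrow> x = u \<or> x = t"
    and Nt: "\<And>x. x \<in> V \<Longrightarrow> (t, x) \<in> E \<Longrightarrow> x = p \<or> x = z"
  shows "\<exists>A' Out' rk'. weak_model V E A' Out' rk' \<and> irregulars V A' Out' \<subset> irregulars V A Out"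
proof -
  have pV: "p \<in> V" and zV: "z \<in> V" using p(1) A_sub a Out_sub[OF t(1)] t(2) by blast+
  have uV: "u \<in> V" using p pV Out_sub by blast
  have Oa: "Out a = {u}" using a by (auto simp: irregular_def)
  have up: "rk u < rk p" and pa: "rk p < rk a" and pt: "rk p < rk t" and pz: "rk p < rk z"
    using Out_rk[OF pV p(3)] A_rk[OF a(1) p(1)] Out_rk[OF t(1), of p] t(2) A_rk[OF zV, of p] z by auto
  have ne: "u \<noteq> p" "u \<noteq> t" "u \<noteq> z" "u \<noteq> a" "p \<noteq> t" "p \<noteq> z" "p \<noteq> a" using up pa pt pz by auto
  have Op: "Out p = {u}"
  proof -
    have "x = u" if "x \<in> Out p" for x
      using Np[of x] that E_iff[OF pV, of x] Out_sub[OF pV] Out_rk[OF pV that] pt by fastforce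
    thus ?thesis using p(3) by blast
  qed
  have at: "a \<noteq> t" using Oa t(2) ne by auto
  have tA: "t \<notin> A p" using A_irrefl t by blast
  have pA: "p \<notin> A p" using A_irrefl pV by blast
  define D where "D = {x \<in> V. x = p \<or> x = t \<or> p \<in> A x \<or> t \<in> A x}"
  define B where "B = A u \<union> Out u"
  have DV: "D \<subseteq> V" by (auto simp: D_def)
  have inD: "p \<in> D" "t \<in> D" "a \<in> D" "z \<in> D" using pV t a zV z p by (auto simp: D_def)
  have D_rk: "rk u < rk d" if "d \<in> D" for d
    using that up pt A_rk[of d p] A_rk[of d t] by (fastforce simp: D_def)
  have B_rk: "rk b < rk u" if "b \<in> B" for b
    using that A_rk[OF uV] Out_rk[OF uV] by (auto simp: B_def)
  have BV: "B \<subseteq> V" using A_sub[OF uV] Out_sub[OF uV] by (auto simp: B_def)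
  have BD: "B \<inter> D = {}" using D_rk B_rk by fastforce
  have uD: "u \<notin> D" using D_rk by blast
  have brB: "branch A B" using u_reg by (auto simp: regular_def B_def Un_commute)
  have outA: "A x \<inter> D = {}" if "x \<in> V - D" for x
    using that A_trans[of x] by (auto simp: D_def)
  \<comment> \<open>As \<open>t\<close> and \<open>p\<close> have the same frames around them, the
    chain property puts every further frame around \<open>d\<close> at or inside one of the
    two.\<close>
  have inA: "A d - A p \<subseteq> D" if d: "d \<in> D" for d
  proof
    fix b assume b: "b \<in> A d - A p"
    have bV: "b \<in> V" using b d A_sub DV by blast
    consider "d = p" | "d = t" | "p \<in> A d" | "t \<in> A d" using d by (auto simp: D_def)
    thus "b \<in> D"
    proof cases
      case 3
      thus ?thesis using b bV A_chain[of d b p] d DV by (auto simp: D_def)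
    next
      case 4
      thus ?thesis using b bV A_chain[of d b t] d DV t(3) by (auto simp: D_def)
    qed (use b t in auto)
  qed
  have pt_nbr: "x \<in> D \<or> x = u" if "x \<in> V" "q \<in> {p, t}" "(q, x) \<in> E" for q x
    using Np Nt that inD by blast
  \<comment> \<open>A regular \<open>x\<close> entering a frame inside \<open>p\<close> or
    \<open>t\<close> would enter \<open>p\<close> or \<open>t\<close> itself or lie inside it. The
    targets of irregular vertices are too far left to belong to \<open>D\<close>.\<close>
  have OutD: "Out x \<inter> D = {}" if x: "x \<in> V - D" for x
  proof (rule ccontr)
    assume "Out x \<inter> D \<noteq> {}"
    then obtain y where y: "y \<in> Out x" "y \<in> D" by blast
    have q: "q \<notin> Out x" if "q \<in> {p, t}" for q
    proof
      assume "q \<in> Out x"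
      hence "x = u" using pt_nbr[of x q] E_iff[of q x] that x pV t(1) by blast
      thus False using Out_rk[OF uV, of q] D_rk[of q] inD that \<open>q \<in> Out x\<close> by force
    qed
    have "regular A Out x"
    proof (rule ccontr)
      assume n: "\<not> regular A Out x"
      then obtain w where w: "irregular A Out x w" using weak x by blast
      hence "w = y" using y by (auto simp: irregular_def)
      thus False using u_max[OF _ n w] x D_rk[OF y(2)] by auto
    qed
    hence "A y \<subseteq> Out x \<union> A x" using y by (auto simp: regular_def branch_def)
    moreover have "p \<notin> A x" "t \<notin> A x" using x by (auto simp: D_def)
    ultimately show False using y q by (auto simp: D_def)
  qed
  have desc: "regular A Out d \<and> Out d \<subseteq> D" if d: "d \<in> V" "p \<in> A d \<or> t \<in> A d" "d \<noteq> a" for d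
  proof -
    obtain q where q: "q \<in> {p, t}" "q \<in> A d" using d by blast
    \<comment> \<open>An irregular frame inside \<open>p\<close> equals \<open>a\<close>, so
      \<open>d\<close> lies inside \<open>t\<close>. By maximality of \<open>u\<close> its target is
      not inside \<open>t\<close>, hence is entered by \<open>t\<close>; but both \<open>p\<close>
      and \<open>z\<close> start to the right of \<open>u\<close>.\<close>
    have reg: "regular A Out d"
    proof (rule ccontr)
      assume n: "\<not> regular A Out d"
      hence "t \<in> A d" using uniq d by blast
      obtain w where w: "irregular A Out d w" using weak d n by blast
      have wu: "rk w \<le> rk u" using u_max d n w by blast
      have "w \<in> V" using w d Out_sub by (auto simp: irregular_def)
      hence "t \<notin> A w" using wu A_rk[of w t] up pt by fastforce
      hence "w \<in> Out t" using w \<open>t \<in> A d\<close> by (auto simp: irregular_def)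
      thus False using t(2) wu up pz by auto
    qed
    have "c \<in> D" if c: "c \<in> Out d" for c
    proof -
      have cA: "c \<notin> A d" using reg c by (auto simp: regular_def)
      have "c = q \<or> c \<in> A q \<or> q \<in> A c" using reg c q by (auto simp: regular_def branch_def)
      hence "q \<in> A c" using cA q A_trans[OF d(1) q(2)] by blast
      thus ?thesis using q c Out_sub d(1) by (auto simp: D_def)
    qed
    thus ?thesis using reg by blast
  qed
  \<comment> \<open>Move \<open>D\<close> inside the innermost frame of \<open>B\<close>; to let \<open>u\<close> enter \<open>p\<close> and \<open>a\<close>, shift \<open>u\<close> and all
    frames outside \<open>D\<close> that start right of it past \<open>D\<close>.\<close>
  define A' where "A' x = (if x \<in> D then (A x - A p) \<union> B else A x)" for x
  define Out' where "Out' x = (if x = u then insert p (insert a (Out u)) else if x = p \<or> x = a then {} else Out x)" for x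
  \<comment> \<open>The shift gives \<open>u\<close> the new rank \<open>rk a + 1\<close>, beyond
    the two frames that it is to enter.\<close>
  define C where "C = rk a - rk u + 1"
  define rk' where "rk' x = (if x \<in> D \<or> rk x < rk u then rk x else rk x + C)" for x
  have C: "C > 0" using up pa by (simp add: C_def)
  have A'B: "A' b = A b" if "b \<in> B" for b using BD that by (auto simp: A'_def)
  have A'tr: "A' b \<subseteq> A' x" if x: "x \<in> V" and b: "b \<in> A' x" for x b
  proof (cases "x \<in> D")
    case False
    hence "b \<in> A x" "b \<notin> D" using b outA x by (auto simp: A'_def)
    thus ?thesis using False A_trans[OF x] by (auto simp: A'_def)
  next
    case True
    show ?thesis
    proof (cases "b \<in> B")
      case True
      thus ?thesis using \<open>x \<in> D\<close> A'B brB by (auto simp: A'_def branch_def)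
    next
      case False
      hence "b \<in> A x - A p" using b True by (auto simp: A'_def)
      thus ?thesis using inA[OF True] True A_trans[OF x, of b] by (auto simp: A'_def)
    qed
  qed
  have A'ch: "c = b \<or> c \<in> A' b \<or> b \<in> A' c" if x: "x \<in> V" and b: "b \<in> A' x" and c: "c \<in> A' x" for x b c
  proof (cases "x \<in> D")
    case False
    hence "b \<in> A x" "b \<notin> D" "c \<in> A x" "c \<notin> D" using b c outA x by (auto simp: A'_def)
    thus ?thesis using A_chain[OF x] by (auto simp: A'_def)
  next
    case True
    have *: "e \<in> D \<and> e \<in> A x \<and> e \<notin> A p \<or> e \<in> B \<and> e \<notin> D" if "e \<in> A' x" for e
      using that True inA[OF True] BD by (auto simp: A'_def)
    show ?thesis using *[OF b] *[OF c] A_chain[OF x, of b c] A'B brB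
      unfolding branch_def by (auto simp: A'_def)
  qed
  have brA': "branch A' (A' x)" if "x \<in> V" for x
    unfolding branch_def using A'tr A'ch that by blast
  have A'p: "A' p = B" and A't: "A' t = B" and A'z: "A' z = insert p B" and A'a: "A' a = insert p B"
    using inD t z p pA by (auto simp: A'_def)
  have A'u: "A' u = A u" using uD by (simp add: A'_def)
  have reg_p: "regular A' Out' p" "regular A' Out' a"
    using brA' pV a ne by (auto simp: regular_def Out'_def)
  have brB': "branch A' B" using brA'[OF pV] A'p by simp
  have reg_u: "regular A' Out' u"
  proof -
    have "branch A' (insert p (insert a B))"
      using brB' A'p A'a unfolding branch_def by auto
    moreover have "Out' u \<union> A' u = insert p (insert a B)" by (auto simp: Out'_def A'u B_def)
    moreover have "A u \<inter> Out u = {}" using A_Out_disj uV .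
    moreover have "p \<notin> A u" "a \<notin> A u" using outA[of u] uV uD inD by blast+
    ultimately show ?thesis by (auto simp: regular_def A'u Out'_def)
  qed
  have reg_t: "regular A' Out' t"
  proof -
    have "branch A' (insert p (insert z B))"
      using brB' A'p A'z unfolding branch_def by auto
    moreover have "Out' t = {p, z}" using ne at t by (auto simp: Out'_def)
    moreover have "{p, z} \<inter> B = {}" using inD BD by blast
    ultimately show ?thesis using A't by (auto simp: regular_def insert_commute)
  qed
  have reg: "regular A' Out' x" if x: "x \<in> V" "regular A Out x" for x
  proof (cases "x = u \<or> x = t \<or> x = p \<or> x = a")
    case True
    thus ?thesis using reg_u reg_t reg_p by blast
  next
    case False
    hence O: "Out' x = Out x" by (auto simp: Out'_def)
    show ?thesis
    proof (cases "x \<in> D")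
      case xD: False
      have "(Out x \<union> A x) \<inter> D = {}" using xD outA OutD x by blast
      hence "branch A' (Out x \<union> A x)"
        using x(2) unfolding regular_def branch_def A'_def by (auto; blast)
      thus ?thesis using x(2) O xD by (simp add: regular_def A'_def)
    next
      case xD: True
      hence "p \<in> A x \<or> t \<in> A x" using False by (auto simp: D_def)
      hence OD: "Out x \<subseteq> D" using desc x(1) False by blast
      have b: "branch A (Out x \<union> A x)" "Out x \<inter> A x = {}" using x by (auto simp: regular_def)
      have A'x: "A' x = (A x - A p) \<union> B" using xD by (simp add: A'_def)
      have "branch A' (Out x \<union> A' x)"
        unfolding branch_def
      proof (intro conjI ballI)
        fix c assume c: "c \<in> Out x \<union> A' x"
        show "A' c \<subseteq> Out x \<union> A' x"
        proof (cases "c \<in> Out x")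
          case True
          hence "A' c = (A c - A p) \<union> B" "A c \<subseteq> Out x \<union> A x"
            using OD b(1) by (auto simp: A'_def branch_def)
          thus ?thesis using A'x by blast
        next
          case False
          thus ?thesis using c A'tr x(1) by blast
        qed
        fix d assume d: "d \<in> Out x \<union> A' x"
        \<comment> \<open>The members of the branch split into some in \<open>D\<close>, still
          compared as before, and some in \<open>B\<close>, which are now around every frame of
          \<open>D\<close>.\<close>
        have cd: "e \<in> D \<and> e \<in> Out x \<union> A x \<and> e \<notin> A p \<or> e \<in> B \<and> e \<notin> D" if e: "e \<in> Out x \<union> A' x" for e
        proof (cases "e \<in> Out x")
          case True
          have "e \<notin> A p"
          proof
            assume eAp: "e \<in> A p"
            have "p \<in> A x \<or> t \<in> A x" by fact
            hence "A p \<subseteq> A x" using A_trans[OF x(1)] t(3) by blast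
            thus False using b(2) eAp True by blast
          qed
          thus ?thesis using True OD by blast
        next
          case False
          thus ?thesis using e A'x inA[OF xD] BD by blast
        qed
        show "c = d \<or> c \<in> A' d \<or> d \<in> A' c"
          using cd[OF c] cd[OF d] b(1) A'B brB unfolding branch_def by (auto simp: A'_def)
      qed
      moreover have "Out x \<inter> A' x = {}" using b(2) OD BD A'x by blast
      ultimately show ?thesis using O by (simp add: regular_def)
    qed
  qed
  have "weak_model V E A' Out' rk'"
  proof
    fix x assume x: "x \<in> V"
    show "A' x \<subseteq> V" using A_sub[OF x] BV by (auto simp: A'_def)
    show "Out' x \<subseteq> V" using Out_sub x pV a(1) by (auto simp: Out'_def)
    show "regular A' Out' x \<or> (\<exists>w. irregular A' Out' x w)"
    proof (cases "regular A Out x \<or> x = p \<or> x = a")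
      case True
      thus ?thesis using reg reg_p x by blast
    next
      case False
      then obtain w where w: "irregular A Out x w" using weak x by blast
      have "x \<noteq> u" "x \<noteq> t" using False u_reg t(2) w ne by (auto simp: irregular_def)
      hence xD: "x \<notin> D" using desc False x by (auto simp: D_def)
      have "w \<notin> D" using OutD[of x] x xD w by (auto simp: irregular_def)
      hence "irregular A' Out' x w"
        using w xD outA[of x] x \<open>x \<noteq> u\<close> False inD by (auto simp: irregular_def A'_def Out'_def)
      thus ?thesis by blast
    qed
    fix b
    show "rk' b < rk' x" if "b \<in> A' x"
    proof (cases "x \<in> D")
      case True
      thus ?thesis using that inA[OF True] A_rk[OF x, of b] B_rk[of b] D_rk[OF True]
        by (auto simp: A'_def rk'_def)
    next
      case False
      thus ?thesis using that outA[of x] x A_rk[OF x, of b] C by (auto simp: A'_def rk'_def)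
    qed
    show "rk' b < rk' x" if b: "b \<in> Out' x"
    proof (cases "x = u")
      case True
      hence "b = p \<or> b = a \<or> b \<in> Out u" using b by (auto simp: Out'_def)
      thus ?thesis using True C_def up pa inD uD Out_rk[OF uV, of b] C by (auto simp: rk'_def)
    next
      case False
      hence bx: "b \<in> Out x" "x \<noteq> p" "x \<noteq> a" using b by (auto simp: Out'_def split: if_splits)
      show ?thesis
      proof (cases "x \<in> D")
        case True
        hence "b \<in> D" using desc[OF x] bx inD t by (auto simp: D_def)
        thus ?thesis using True Out_rk[OF x bx(1)] by (auto simp: rk'_def)
      next
        case xD: False
        hence "b \<notin> D" using OutD x bx by blast
        thus ?thesis using xD Out_rk[OF x bx(1)] C by (auto simp: rk'_def)
      qed
    qed
    show "A' b \<subseteq> A' x" if "b \<in> A' x" using A'tr[OF x that] .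
    show "b = c \<or> b \<in> A' c \<or> c \<in> A' b" if "b \<in> A' x" "c \<in> A' x" for c using A'ch[OF x that(2,1)] .
    show "(x, y) \<in> E \<longleftrightarrow> x \<in> Out' y \<or> y \<in> Out' x" if y: "y \<in> V" for y
    proof -
      have "p \<notin> Out u" "a \<notin> Out u" "p \<notin> Out a" "a \<notin> Out p"
        using OutD[of u] uV uD inD Oa Op ne by auto
      thus ?thesis using E_iff[OF x y] Oa Op ne unfolding Out'_def by auto
    qed
  qed (rule fin)
  moreover have "irregulars V A' Out' \<subseteq> irregulars V A Out"
    using reg by (auto simp: irregulars_def)
  moreover have "a \<in> irregulars V A Out" "a \<notin> irregulars V A' Out'"
    using a reg_p by (auto simp: irregulars_def)
  ultimately show ?thesis by blast
qed

end

text \<open>The siblings of \<open>a\<close> from which entering successive siblings (or frames inside them) ends at \<open>a\<close>.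
  A regular sibling enters at most one other sibling, so the clusters of distinct irregular siblings
  are disjoint.\<close>

inductive_set cluster :: "'a set \<Rightarrow> ('a \<Rightarrow> 'a set) \<Rightarrow> ('a \<Rightarrow> 'a set) \<Rightarrow> 'a \<Rightarrow> 'a set"
  for V A Out a where
  base: "a \<in> cluster V A Out a"
| step: "r \<in> V \<Longrightarrow> A r = A a \<Longrightarrow> regular A Out r \<Longrightarrow> z \<in> cluster V A Out a \<Longrightarrow> z \<in> Out r \<Longrightarrow>
    r \<in> cluster V A Out a"

section \<open>Clusters and the choice of a move\<close>

context weak_model
begin

lemma cluster_sibling: "z \<in> cluster V A Out a \<Longrightarrow> a \<in> V \<Longrightarrow> z \<in> V \<and> A z = A a"
  by (induction rule: cluster.induct) auto

lemma cluster_irregular: "z \<in> cluster V A Out a \<Longrightarrow> \<not> regular A Out z \<Longrightarrow> z = a"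
  by (induction rule: cluster.induct) auto

lemma sibling_unique:
  assumes "regular A Out r" "z \<in> Out r" "z' \<in> Out r" "A z = A z'" "r \<in> V"
  shows "z = z'"
proof -
  have "z = z' \<or> z \<in> A z' \<or> z' \<in> A z"
    using assms(1-3) unfolding regular_def branch_def by blast
  thus ?thesis using assms A_irrefl Out_sub by blast
qed

text \<open>By \<open>sibling_unique\<close> a regular member determines the next sibling, hence the
  irregular frame where the walk ends. The induction follows the walk step by step.\<close>

lemma cluster_disjoint:
  assumes "z \<in> cluster V A Out a" "z \<in> cluster V A Out b" "\<not> regular A Out a" "\<not> regular A Out b"
    "a \<in> V" "b \<in> V" "A a = A b"
  shows "a = b"
  using assms(1,2)
proof (induction rule: cluster.induct)
  case base
  thus ?case using cluster_irregular assms(3) by blast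
next
  case (step r z)
  obtain z' where z': "z' \<in> cluster V A Out b" "z' \<in> Out r"
    using step.prems step.hyps(3) assms(4) by (cases rule: cluster.cases) auto
  have "A z' = A z"
    using cluster_sibling[OF z'(1) assms(6)] cluster_sibling[OF step.hyps(4) assms(5)] assms(7) by simp
  hence "z' = z"
    using sibling_unique[OF step.hyps(3) z'(2) step.hyps(5) _ step.hyps(1)] by blast
  thus ?case using step.IH z' by blast
qed

text \<open>The cluster of \<open>a\<close> and its contents qualify as the \<open>X\<close> of
  \<open>move_component\<close>, unless some \<open>t\<close> enters both \<open>p\<close> and a
  member of the cluster. As \<open>stuck\<close> forbids every repair, such a \<open>t\<close>
  exists.\<close>

lemma cluster_exit:
  assumes a: "a \<in> V" "\<not> regular A Out a" "irregular A Out a u"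
    and p: "p \<in> A a" "A a = insert p (A p)"
    and u_max: "\<And>x w. x \<in> V \<Longrightarrow> \<not> regular A Out x \<Longrightarrow> irregular A Out x w \<Longrightarrow> rk w < rk p"
    and child: "\<And>x. x \<in> V \<Longrightarrow> p \<in> A x \<Longrightarrow> \<not> regular A Out x \<Longrightarrow> irregular A Out x u \<and> A x = A a"
    and stuck: "\<And>A' Out' rk'. weak_model V E A' Out' rk' \<Longrightarrow> \<not> irregulars V A' Out' \<subset> irregulars V A Out"
  shows "\<exists>t\<in>V. \<exists>z\<in>cluster V A Out a. regular A Out t \<and> p \<in> Out t \<and> z \<in> Out t"
proof (rule ccontr)
  assume no: "\<not> ?thesis"
  let ?Z = "cluster V A Out a"
  define X where "X = {y \<in> V. \<exists>z\<in>?Z. y = z \<or> z \<in> A y}"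
  have Z: "z \<in> V" "A z = A a" if "z \<in> ?Z" for z using cluster_sibling that a by auto
  have XV: "X \<subseteq> V" by (auto simp: X_def)
  have aX: "a \<in> X" using a(1) cluster.base[of a V A Out] unfolding X_def by blast
  have pX: "p \<in> A x" if "x \<in> X" for x
    using that p Z A_trans[of x] unfolding X_def by blast
  have Xdown: "y \<in> X" if "x \<in> X" "y \<in> V" "x \<in> A y" for x y
    using that A_trans[of y x] unfolding X_def by blast
  have Xup: "A x - A a \<subseteq> X" if "x \<in> X" for x
  proof
    fix e assume e: "e \<in> A x - A a"
    have xV: "x \<in> V" using that XV by blast
    from that obtain z where z: "z \<in> ?Z" "x = z \<or> z \<in> A x" unfolding X_def by blast
    hence "z \<in> A x" using e Z by blast
    hence "e = z \<or> z \<in> A e" using A_chain[OF xV, of e z] e Z z by blast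
    thus "e \<in> X" using z e A_sub xV by (auto simp: X_def)
  qed
  have "x = a \<and> y = u" if x: "x \<in> X" and y: "y \<in> V - X" and E: "(x, y) \<in> E" for x y
  proof -
    have xV: "x \<in> V" and yV: "y \<in> V" using x y XV by auto
    obtain z where z: "z \<in> ?Z" "x = z \<or> z \<in> A x" using x unfolding X_def by blast
    have yX: "z' \<notin> A y" "y \<noteq> z'" if "z' \<in> ?Z" for z' using y that by (auto simp: X_def)
    consider "y \<in> Out x" | "x \<in> Out y" using E E_iff xV yV by blast
    thus ?thesis
    proof cases
      case 1
      show ?thesis
      proof (cases "regular A Out x")
        case False
        hence i: "irregular A Out x u" "A x = A a" using child[OF xV pX[OF x]] by auto
        have "z \<notin> A x" using A_irrefl[of z] Z z(1) i(2) by auto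
        hence "x = z" using z(2) by blast
        hence "x = a" using z(1) False cluster_irregular by blast
        thus ?thesis using i 1 by (auto simp: irregular_def)
      next
        case True
        \<comment> \<open>\<open>y\<close> is comparable with a cluster member around
          \<open>x\<close> or entered by \<open>x\<close>, and is neither equal to it nor inside it.
          So \<open>y\<close> is around that member and therefore around \<open>x\<close>, although
          \<open>x\<close> enters \<open>y\<close>.\<close>
        have cmp: "c = y \<or> c \<in> A y \<or> y \<in> A c" if "c \<in> Out x \<union> A x" for c
          using True 1 that by (auto simp: regular_def branch_def)
        have yA: "y \<notin> A x" using True 1 by (auto simp: regular_def)
        show ?thesis
        proof (cases "x = z")
          case False
          hence "z \<in> A x" using z by blast
          hence "y \<in> A z" using cmp[of z] yX[OF z(1)] by blast
          thus ?thesis using yA A_trans[OF xV \<open>z \<in> A x\<close>] by blast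
        next
          case xz: True
          have "x \<noteq> a" using True a by blast
          then obtain z' where z': "z' \<in> ?Z" "z' \<in> Out x"
            using z(1) xz by (auto elim: cluster.cases)
          hence "y \<in> A z'" using cmp[of z'] yX[OF z'(1)] by blast
          thus ?thesis using yA Z z' z xz by auto
        qed
      qed
    next
      case 2
      \<comment> \<open>Here an outside frame \<open>y\<close> enters \<open>X\<close>. Being
        regular, it enters \<open>z\<close>; as it does not also enter \<open>p\<close>, it lies
        inside \<open>p\<close>, is a sibling of \<open>z\<close> and belongs to the cluster after
        all.\<close>
      have reg: "regular A Out y"
      proof (rule ccontr)
        assume n: "\<not> regular A Out y"
        then obtain w where w: "irregular A Out y w" using weak yV by blast
        hence "w = x" using 2 by (auto simp: irregular_def)
        thus False using u_max[OF yV n w] A_rk[OF xV pX[OF x]] by simp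
      qed
      have "z \<in> Out y \<union> A y" using z 2 reg by (auto simp: regular_def branch_def)
      hence zO: "z \<in> Out y" using yX z by blast
      have pz: "p \<in> A z" using Z z p by auto
      hence "p \<in> Out y \<union> A y" using zO reg by (auto simp: regular_def branch_def)
      hence pA: "p \<in> A y" using no yV z zO reg by blast
      have cmp: "c = z \<or> c \<in> A z \<or> z \<in> A c" if "c \<in> A y" for c
        using reg zO that by (auto simp: regular_def branch_def)
      have "A y \<subseteq> A z" using cmp yX[OF z(1)] A_trans[OF yV] by blast
      moreover have "A z \<subseteq> A y" using Z[OF z(1)] p pA A_trans[OF yV] by auto
      ultimately have "A y = A a" using Z z by blast
      hence "y \<in> ?Z" using cluster.step[OF yV _ reg z(1) zO] by blast
      thus ?thesis using y by (auto simp: X_def)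
    qed
  qed
  hence "\<exists>A' Out' rk'. weak_model V E A' Out' rk' \<and> irregulars V A' Out' \<subset> irregulars V A Out"
    by (intro move_component[OF a p XV aX pX Xup Xdown]) auto
  thus False using stuck by blast
qed

text \<open>If no move applies, failure of \<open>move_target\<close> puts all targets in
  \<open>B\<close>, and failure of \<open>move_component\<close> produces \<open>t\<close> through
  \<open>cluster_exit\<close>. The degree conditions then supply the hypotheses of
  \<open>move_across_cutvertex\<close>.\<close>

lemma fewer_irregulars:
  assumes BE: "\<And>b c. b \<in> B \<Longrightarrow> c \<in> B \<Longrightarrow> (b, c) \<notin> E"
    and B1: "\<And>x b c. x \<in> V \<Longrightarrow> b \<in> B \<Longrightarrow> c \<in> B \<Longrightarrow> (x, b) \<in> E \<Longrightarrow> (x, c) \<in> E \<Longrightarrow> b = c"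
    and deg2: "\<And>x b c d. x \<in> V - B \<Longrightarrow> (x, b) \<in> E \<Longrightarrow> (x, c) \<in> E \<Longrightarrow> (x, d) \<in> E \<Longrightarrow> b \<noteq> c \<Longrightarrow> d = b \<or> d = c"
    and ne: "irregulars V A Out \<noteq> {}"
  shows "\<exists>A' Out' rk'. weak_model V E A' Out' rk' \<and> irregulars V A' Out' \<subset> irregulars V A Out"
proof (rule ccontr)
  assume "\<not> ?thesis"
  hence stuck: "\<not> irregulars V A' Out' \<subset> irregulars V A Out" if "weak_model V E A' Out' rk'" for A' Out' rk'
    using that by blast
  have target_B: "u \<in> B" if v: "v \<in> V" "\<not> regular A Out v" "irregular A Out v u" for u v
  proof (rule ccontr)
    assume "u \<notin> B"
    obtain p where p: "p \<in> A v" "A v = insert p (A p)" "u \<in> Out p" using irregular_parent[OF v] by blast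
    have V: "p \<in> V" "u \<in> V" using p v A_sub Out_sub by blast+
    have "(u, p) \<in> E" "(u, v) \<in> E" using V p v E_iff by (auto simp: irregular_def)
    moreover have "p \<noteq> v" using p A_irrefl v by blast
    ultimately have "x = p \<or> x = v" if "(u, x) \<in> E" for x
      using deg2[of u p v x] \<open>u \<notin> B\<close> V that by blast
    thus False using move_target[OF v p] stuck by blast
  qed
  \<comment> \<open>Triples of an irregular vertex, its target and its parent, so that target and
    parent can be maximised one after the other.\<close>
  define S where "S = {(x, w, q). x \<in> V \<and> \<not> regular A Out x \<and> irregular A Out x w \<and>
    q \<in> A x \<and> A x = insert q (A q) \<and> w \<in> Out q}"
  have "S \<subseteq> V \<times> V \<times> V" using A_sub Out_sub by (fastforce simp: S_def)
  hence fS: "finite S" by (rule finite_subset) (simp add: fin)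
  have S_ex: "\<exists>q. (x, w, q) \<in> S" if x: "x \<in> V" "\<not> regular A Out x" "irregular A Out x w" for x w
  proof -
    obtain q where q: "q \<in> A x" "A x = insert q (A q)" "w \<in> Out q" using irregular_parent[OF x] .
    have "(x, w, q) \<in> S" unfolding S_def mem_Collect_eq prod.case by (intro conjI x q)
    thus ?thesis ..
  qed
  obtain v where "v \<in> V" "\<not> regular A Out v" using ne by (auto simp: irregulars_def)
  hence "S \<noteq> {}" using S_ex weak by blast
  then obtain s where s: "s \<in> S" "\<And>y. y \<in> S \<Longrightarrow> rk (fst (snd y)) \<le> rk (fst (snd s))"
    using finite_has_max_image[OF fS, of "\<lambda>y. rk (fst (snd y))"] by blast
  define S' where "S' = {y \<in> S. fst (snd y) = fst (snd s)}"
  have "finite S'" using fS by (simp add: S'_def)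
  moreover have "s \<in> S'" using s(1) by (simp add: S'_def)
  hence "S' \<noteq> {}" by blast
  ultimately obtain s' where s': "s' \<in> S'" "\<And>y. y \<in> S' \<Longrightarrow> rk (snd (snd y)) \<le> rk (snd (snd s'))"
    using finite_has_max_image[of S' "\<lambda>y. rk (snd (snd y))"] by blast
  \<comment> \<open>\<open>u\<close> is rightmost among the frames entered by irregular vertices, and then \<open>p\<close> rightmost.\<close>
  obtain a u p where aup: "s' = (a, u, p)" by (cases s')
  have us: "u = fst (snd s)" using s' aup by (auto simp: S'_def)
  have a: "a \<in> V" "\<not> regular A Out a" "irregular A Out a u"
    and p: "p \<in> A a" "A a = insert p (A p)" and pu: "u \<in> Out p"
    using s'(1) aup by (auto simp: S'_def S_def)
  have u_max: "rk w \<le> rk u" if x: "x \<in> V" "\<not> regular A Out x" "irregular A Out x w" for x w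
    using S_ex[OF x] s(2) us by force
  have p_max: "rk q \<le> rk p" if "(x, u, q) \<in> S" for x q
    using s'(2)[of "(x, u, q)"] that us aup by (auto simp: S'_def)
  have pV: "p \<in> V" using p A_sub a by blast
  have uV: "u \<in> V" using pu pV Out_sub by blast
  have up: "rk u < rk p" using Out_rk[OF pV pu] .
  have uB: "u \<in> B" using target_B a by blast
  \<comment> \<open>By maximality of \<open>u\<close> the target of \<open>x\<close> is not inside
    \<open>p\<close>, so \<open>p\<close> enters it; as \<open>p\<close> has at most one neighbour
    in \<open>B\<close>, this target is \<open>u\<close>. Maximality of \<open>p\<close> then makes
    \<open>p\<close> the parent of \<open>x\<close>.\<close>
  have child: "irregular A Out x u \<and> A x = A a" if x: "x \<in> V" "p \<in> A x" "\<not> regular A Out x" for x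
  proof -
    obtain w where w: "irregular A Out x w" using weak x by blast
    have wV: "w \<in> V" using w Out_sub x by (auto simp: irregular_def)
    have "p \<notin> A w" using A_rk[OF wV, of p] u_max[OF x(1,3) w] up by auto
    hence "w \<in> Out p" using w x by (auto simp: irregular_def)
    hence "w = u"
      using B1[OF pV, of w u] target_B[OF x(1,3) w] uB pu E_iff pV uV wV by blast
    hence wu: "irregular A Out x u" using w by simp
    obtain q where q: "(x, u, q) \<in> S" using S_ex[OF x(1,3) wu] by blast
    hence qV: "q \<in> A x" "A x = insert q (A q)" unfolding S_def by blast+
    have "q \<in> V" using A_sub[OF x(1)] qV(1) by (rule subsetD)
    hence "p \<notin> A q" using p_max[OF q] A_rk[of q p] by (meson not_less)
    moreover have "p \<in> insert q (A q)" using x(2) qV(2) by simp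
    ultimately have "p = q" by simp
    thus ?thesis using wu p qV by simp
  qed
  have exit: "\<exists>t\<in>V. \<exists>z\<in>cluster V A Out x. regular A Out t \<and> p \<in> Out t \<and> z \<in> Out t"
    if x: "x \<in> V" "\<not> regular A Out x" "p \<in> A x" for x
  proof -
    have c: "irregular A Out x u" "A x = A a" using child x by auto
    show ?thesis
    proof (rule cluster_exit[OF x(1,2) c(1) x(3)])
      show "A x = insert p (A p)" using c p by simp
      show "rk w < rk p" if "y \<in> V" "\<not> regular A Out y" "irregular A Out y w" for y w
        using u_max[OF that] up by simp
      show "irregular A Out y u \<and> A y = A x" if "y \<in> V" "p \<in> A y" "\<not> regular A Out y" for y
        using child[OF that] c by simp
      show "\<not> irregulars V A' Out' \<subset> irregulars V A Out" if "weak_model V E A' Out' rk'" for A' Out' rk'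
        using stuck[OF that] .
    qed
  qed
  obtain t z where t: "t \<in> V" "regular A Out t" "p \<in> Out t" "z \<in> Out t" and z: "z \<in> cluster V A Out a"
    using exit[OF a(1,2) p(1)] by blast
  have zV: "z \<in> V" and Az: "A z = insert p (A p)" using cluster_sibling[OF z a(1)] p by auto
  have pt: "rk p < rk t" using Out_rk t by blast
  have pz: "p \<noteq> z" using Az A_irrefl[OF zV] by blast
  \<comment> \<open>Next to the branch vertex \<open>u\<close>, the frame \<open>p\<close> is no
    branch vertex; and \<open>t\<close>, another neighbour of \<open>p\<close>, is none either. So
    both have degree two and all their neighbours are known.\<close>
  have pB: "p \<notin> B" using BE[of p u] uB E_iff pV uV pu by blast
  have Np: "x = u \<or> x = t" if "(p, x) \<in> E" for x
    using deg2[of p u t x] pV pB that E_iff[OF pV uV] E_iff[OF pV t(1)] pu t(3) up pt by fastforce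
  have tB: "t \<notin> B" using B1[OF pV, of t u] uB E_iff[OF pV uV] E_iff[OF pV t(1)] pu t(3) up pt by fastforce
  have Nt: "x = p \<or> x = z" if "(t, x) \<in> E" for x
    using deg2[of t p z x] t tB pz that E_iff[OF t(1) pV] E_iff[OF t(1) zV] by blast
  have Ot: "Out t = {p, z}"
  proof -
    have "x \<in> {p, z}" if "x \<in> Out t" for x
      using Nt[of x] E_iff[OF t(1), of x] Out_sub[OF t(1)] that by blast
    thus ?thesis using t by blast
  qed
  have At: "A t = A p"
  proof
    have "A p \<subseteq> {p, z} \<union> A t" using t Ot by (auto simp: regular_def branch_def)
    moreover have "p \<notin> A p" "z \<notin> A p" using A_irrefl[OF pV] A_asym[OF pV, of z] Az by auto
    ultimately show "A p \<subseteq> A t" by auto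
    show "A t \<subseteq> A p"
    proof
      fix e assume e: "e \<in> A t"
      have "e = p \<or> e \<in> A p \<or> p \<in> A e"
        using t(2,3) e unfolding regular_def branch_def by blast
      moreover have "p \<notin> A t" using t(2,3) unfolding regular_def by blast
      ultimately show "e \<in> A p" using subsetD[OF A_trans[OF t(1) e], of p] e by auto
    qed
  qed
  \<comment> \<open>The target of an irregular \<open>u\<close> would be a second branch vertex,
    adjacent to \<open>u\<close>.\<close>
  have u_reg: "regular A Out u"
  proof (rule ccontr)
    assume n: "\<not> regular A Out u"
    then obtain w where w: "irregular A Out u w" using weak uV by blast
    hence "w \<in> V" "(u, w) \<in> E" using Out_sub[OF uV] E_iff[OF uV] by (auto simp: irregular_def)
    thus False using BE target_B[OF uV n w] uB by blast
  qed
  \<comment> \<open>The cluster of any irregular \<open>x\<close> inside \<open>p\<close> has an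
    exit too, which can only be \<open>t\<close>, and it meets the cluster at \<open>z\<close>. So
    the clusters of \<open>x\<close> and \<open>a\<close> intersect.\<close>
  have uniq: "x = a" if x: "x \<in> V" "p \<in> A x" "\<not> regular A Out x" for x
  proof -
    obtain t' z' where t': "t' \<in> V" "p \<in> Out t'" "z' \<in> Out t'" and z': "z' \<in> cluster V A Out x"
      using exit[OF x(1,3,2)] by blast
    have "t' \<noteq> u" using Out_rk[OF t'(1,2)] up by auto
    hence "t' = t" using Np E_iff[OF pV t'(1)] t' by blast
    moreover have "z' \<noteq> p" using cluster_sibling[OF z' x(1)] x(2) A_irrefl pV by blast
    ultimately have "z' = z" using t' Ot by blast
    hence zx: "z \<in> cluster V A Out x" using z' by simp
    have "A a = A x" using child[OF x] by simp
    from cluster_disjoint[OF z zx a(2) x(3) a(1) x(1) this] show ?thesis by (rule sym)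
  qed
  have "\<exists>A' Out' rk'. weak_model V E A' Out' rk' \<and> irregulars V A' Out' \<subset> irregulars V A Out"
  proof (rule move_across_cutvertex[OF a p pu u_reg _ _ t(1) Ot At Az])
    show "rk w \<le> rk u" if "x \<in> V" "\<not> regular A Out x" "irregular A Out x w" for x w
      using u_max that .
    show "x = a" if "x \<in> V" "p \<in> A x" "\<not> regular A Out x" for x using uniq that .
    show "x = u \<or> x = t" if "(p, x) \<in> E" for x using Np that .
    show "x = p \<or> x = z" if "(t, x) \<in> E" for x using Nt that .
  qed
  thus False using stuck by blast
qed

lemma all_regular:
  assumes BE: "\<And>b c. b \<in> B \<Longrightarrow> c \<in> B \<Longrightarrow> (b, c) \<notin> E"
    and B1: "\<And>x b c. x \<in> V \<Longrightarrow> b \<in> B \<Longrightarrow> c \<in> B \<Longrightarrow> (x, b) \<in> E \<Longrightarrow> (x, c) \<in> E \<Longrightarrow> b = c"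
    and deg2: "\<And>x b c d. x \<in> V - B \<Longrightarrow> (x, b) \<in> E \<Longrightarrow> (x, c) \<in> E \<Longrightarrow> (x, d) \<in> E \<Longrightarrow> b \<noteq> c \<Longrightarrow> d = b \<or> d = c"
  shows "\<exists>A' Out' rk'. weak_model V E A' Out' rk' \<and> (\<forall>v\<in>V. regular A' Out' v)"
proof -
  have "\<exists>A' Out' rk'. weak_model V E A' Out' rk' \<and> (\<forall>v\<in>V. regular A' Out' v)"
    if "weak_model V E A1 Out1 rk1" for A1 Out1 rk1
    using that
  proof (induction "card (irregulars V A1 Out1)" arbitrary: A1 Out1 rk1 rule: less_induct)
    case less
    show ?case
    proof (cases "irregulars V A1 Out1 = {}")
      case True
      thus ?thesis using less.prems by (auto simp: irregulars_def)
    next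
      case False
      have "\<exists>A' Out' rk'. weak_model V E A' Out' rk' \<and> irregulars V A' Out' \<subset> irregulars V A1 Out1"
        by (rule weak_model.fewer_irregulars[OF less.prems, of B]) (fact BE B1 deg2 False)+
      then obtain A' Out' rk' where
        m: "weak_model V E A' Out' rk'" "irregulars V A' Out' \<subset> irregulars V A1 Out1"
        by blast
      have "finite (irregulars V A1 Out1)" using fin by (simp add: irregulars_def)
      from less.hyps[OF psubset_card_mono[OF this m(2)] m(1)] show ?thesis .
    qed
  qed
  thus ?thesis using weak_model_axioms .
qed

end

section \<open>Constructing regular models\<close>

text \<open>Finiteness makes \<open>Abs_fset\<close> injective on the stable sets that label copies;
  having some stable set at all allows arbitrary choices in the embeddings.\<close>

definition wf_pair :: "gsp \<Rightarrow> bool" where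
  "wf_pair G \<longleftrightarrow> (case G of (V, E, SS) \<Rightarrow> finite V \<and> SS \<noteq> {} \<and> (\<forall>S\<in>SS. S \<subseteq> V))"

lemma wf_pair_NEXT:
  assumes "wf_pair G" shows "wf_pair (NEXT G)"
proof -
  obtain V E SS where G: "G = (V, E, SS)" by (cases G)
  have V: "finite V" "SS \<noteq> {}" "\<And>S. S \<in> SS \<Longrightarrow> S \<subseteq> V" using assms by (auto simp: wf_pair_def G)
  have fS: "finite SS" using V(1,3) finite_subset[of SS "Pow V"] by blast
  have "{Nw (Abs_fset S) (Abs_fset T) |S T. S \<in> SS \<and> T \<in> SS} =
      (\<lambda>(S, T). Nw (Abs_fset S) (Abs_fset T)) ` (SS \<times> SS)" by auto
  hence "finite {Nw (Abs_fset S) (Abs_fset T) |S T. S \<in> SS \<and> T \<in> SS}" using fS by simp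
  hence fin: "finite (Orig ` V \<union> (\<Union>S\<in>SS. Cp (Abs_fset S) ` V)
      \<union> {Nw (Abs_fset S) (Abs_fset T) |S T. S \<in> SS \<and> T \<in> SS})" (is "finite ?W")
    using V(1) fS by (intro finite_UnI finite_UN_I finite_imageI)
  have W1: "Orig ` S \<union> Cp (Abs_fset S) ` T \<subseteq> ?W" if "S \<in> SS" "T \<in> SS" for S T
    using V(3)[OF that(1)] V(3)[OF that(2)] that(1) by blast
  have W2: "Orig ` S \<union> {Nw (Abs_fset S) (Abs_fset T)} \<subseteq> ?W" if "S \<in> SS" "T \<in> SS" for S T
    using V(3)[OF that(1)] that by blast
  show ?thesis
    unfolding G wf_pair_def NEXT_def prod.case
  proof (intro conjI fin ballI)
    show "{Orig ` S \<union> Cp (Abs_fset S) ` T |S T. S \<in> SS \<and> T \<in> SS} \<union>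
        {Orig ` S \<union> {Nw (Abs_fset S) (Abs_fset T)} |S T. S \<in> SS \<and> T \<in> SS} \<noteq> {}"
      using V(2) by blast
  next
    fix X assume "X \<in> {Orig ` S \<union> Cp (Abs_fset S) ` T |S T. S \<in> SS \<and> T \<in> SS} \<union>
        {Orig ` S \<union> {Nw (Abs_fset S) (Abs_fset T)} |S T. S \<in> SS \<and> T \<in> SS}"
    then consider S T where "S \<in> SS" "T \<in> SS" "X = Orig ` S \<union> Cp (Abs_fset S) ` T"
      | S T where "S \<in> SS" "T \<in> SS" "X = Orig ` S \<union> {Nw (Abs_fset S) (Abs_fset T)}" by blast
    thus "X \<subseteq> ?W"
    proof cases
      case 1
      thus ?thesis using W1[of S T] by simp
    next
      case 2
      thus ?thesis using W2[of S T] by simp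
    qed
  qed
qed

lemma wf_pair_NEXT_pow: "wf_pair ((NEXT ^^ i) G0)"
  by (induction i) (auto simp: wf_pair_NEXT, simp add: G0_def wf_pair_def)

lemma wf_pair_inj:
  assumes "wf_pair (V, E, SS)" "S \<in> SS" "T \<in> SS" "Abs_fset S = Abs_fset T"
  shows "S = T"
proof -
  have "finite S" "finite T" using assms finite_subset by (auto simp: wf_pair_def)
  thus ?thesis using assms(4) Abs_fset_inject by blast
qed

lemma induced_sub_pair_mono:
  "induced_sub_pair V E SS G \<Longrightarrow> TT \<subseteq> SS \<Longrightarrow> induced_sub_pair V E TT G"
  unfolding induced_sub_pair_def by (cases G) (simp, meson subsetD)

lemma induced_sub_pair_NEXT:
  assumes "wf_pair G" "induced_sub_pair V E SS G"
  shows "induced_sub_pair V E SS (NEXT G)"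
proof -
  obtain W F TT where G: "G = (W, F, TT)" by (cases G)
  obtain f where f: "inj_on f V" "f ` V \<subseteq> W"
    "\<forall>u\<in>V. \<forall>v\<in>V. (u, v) \<in> E \<longleftrightarrow> (f u, f v) \<in> F"
    "\<forall>S\<in>SS. \<exists>S'\<in>TT. S = {v \<in> V. f v \<in> S'}"
    using assms(2) by (auto simp: G induced_sub_pair_def)
  obtain W' F' TT' where N: "NEXT G = (W', F', TT')" by (cases "NEXT G")
  have "inj_on (Orig \<circ> f) V" using f(1) by (auto simp: inj_on_def)
  moreover have "(Orig \<circ> f) ` V \<subseteq> W'" using f(2) N by (auto simp: G NEXT_def)
  moreover have "\<forall>u\<in>V. \<forall>v\<in>V. (u, v) \<in> E \<longleftrightarrow> ((Orig \<circ> f) u, (Orig \<circ> f) v) \<in> F'"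
    using f(3) N by (auto simp: G NEXT_def)
  moreover have "\<forall>S\<in>SS. \<exists>S'\<in>TT'. S = {v \<in> V. (Orig \<circ> f) v \<in> S'}"
  proof
    fix S assume "S \<in> SS"
    then obtain S' where S': "S' \<in> TT" "S = {v \<in> V. f v \<in> S'}" using f(4) by blast
    have "Orig ` S' \<union> Cp (Abs_fset S') ` S' \<in> TT'" using S' N by (auto simp: G NEXT_def)
    moreover have "S = {v \<in> V. (Orig \<circ> f) v \<in> Orig ` S' \<union> Cp (Abs_fset S') ` S'}"
      using S'(2) by auto
    ultimately show "\<exists>S'\<in>TT'. S = {v \<in> V. (Orig \<circ> f) v \<in> S'}" by blast
  qed
  ultimately show ?thesis
    unfolding N induced_sub_pair_def prod.case by (intro exI[of _ "Orig \<circ> f"] conjI)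
qed

lemma induced_sub_pair_NEXT_le:
  assumes "induced_sub_pair V E SS ((NEXT ^^ i) G0)" "i \<le> j"
  shows "induced_sub_pair V E SS ((NEXT ^^ j) G0)"
  using assms(2,1)
  by (induction rule: dec_induct) (auto intro: induced_sub_pair_NEXT wf_pair_NEXT_pow)

text \<open>The first NEXT puts \<open>V1\<close> in a copy and creates \<open>r\<close> as a new
  vertex attached to the set with trace \<open>N\<close>. The second keeps this part and puts
  \<open>V2\<close> in the copy belonging to a set that contains \<open>r\<close> but avoids
  \<open>V1\<close>; so sets using that copy contain \<open>r\<close>, and the others avoid
  \<open>V2\<close>.\<close>

lemma induced_sub_pair_attach:
  assumes wf: "wf_pair G"
    and G1: "induced_sub_pair V1 E SS1 G" and G2: "induced_sub_pair V2 E SS2 G"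
    and disj: "V1 \<inter> V2 = {}" "r \<notin> V1" "r \<notin> V2"
    and N: "N \<in> SS1" "\<And>x. x \<in> V1 \<Longrightarrow> (r, x) \<in> E \<longleftrightarrow> x \<in> N" "\<And>x. x \<in> V1 \<Longrightarrow> (x, r) \<in> E \<longleftrightarrow> x \<in> N"
    and none: "(r, r) \<notin> E" "\<And>y. y \<in> V2 \<Longrightarrow> (r, y) \<notin> E" "\<And>y. y \<in> V2 \<Longrightarrow> (y, r) \<notin> E"
      "\<And>x y. x \<in> V1 \<Longrightarrow> y \<in> V2 \<Longrightarrow> (x, y) \<notin> E" "\<And>x y. x \<in> V1 \<Longrightarrow> y \<in> V2 \<Longrightarrow> (y, x) \<notin> E"
  shows "induced_sub_pair (insert r (V1 \<union> V2)) E (SS1 \<union> insert r ` SS2) (NEXT (NEXT G))"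
proof -
  obtain W F TT where G: "G = (W, F, TT)" by (cases G)
  obtain W1 F1 TT1 where N1: "NEXT G = (W1, F1, TT1)" by (cases "NEXT G")
  obtain W2 F2 TT2 where N2: "NEXT (NEXT G) = (W2, F2, TT2)" by (cases "NEXT (NEXT G)")
  have wf1: "wf_pair (W1, F1, TT1)" using wf_pair_NEXT[OF wf] by (simp add: N1)
  have inj0: "S = T" if "S \<in> TT" "T \<in> TT" "Abs_fset S = Abs_fset T" for S T
    using wf_pair_inj[OF wf[unfolded G] that] .
  have inj1: "S = T" if "S \<in> TT1" "T \<in> TT1" "Abs_fset S = Abs_fset T" for S T
    using wf_pair_inj[OF wf1 that] .
  obtain f1 where f1: "inj_on f1 V1" "f1 ` V1 \<subseteq> W"
    "\<forall>u\<in>V1. \<forall>v\<in>V1. (u, v) \<in> E \<longleftrightarrow> (f1 u, f1 v) \<in> F"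
    "\<forall>S\<in>SS1. \<exists>S'\<in>TT. S = {v \<in> V1. f1 v \<in> S'}"
    using G1 by (auto simp: G induced_sub_pair_def)
  obtain f2 where f2: "inj_on f2 V2" "f2 ` V2 \<subseteq> W"
    "\<forall>u\<in>V2. \<forall>v\<in>V2. (u, v) \<in> E \<longleftrightarrow> (f2 u, f2 v) \<in> F"
    "\<forall>S\<in>SS2. \<exists>S'\<in>TT. S = {v \<in> V2. f2 v \<in> S'}"
    using G2 by (auto simp: G induced_sub_pair_def)
  obtain S0 where S0: "S0 \<in> TT" using wf by (auto simp: wf_pair_def G)
  obtain T0 where T0: "T0 \<in> TT" "N = {v \<in> V1. f1 v \<in> T0}" using f1(4) N(1) by blast
  obtain U0 where U0: "U0 \<in> TT1" using wf1 by (auto simp: wf_pair_def)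
  define s0 t0 where "s0 = Abs_fset S0" and "t0 = Abs_fset T0"
  \<comment> \<open>\<open>S0\<close> is arbitrary; what matters is that \<open>S1\<close> contains
    the image of \<open>r\<close> and nothing of the copy holding \<open>V1\<close>.\<close>
  define S1 where "S1 = Orig ` S0 \<union> {Nw s0 t0}"
  define s1 where "s1 = Abs_fset S1"
  have S1: "S1 \<in> TT1"
    using N1 S0 T0(1) by (auto simp: G NEXT_def S1_def s0_def t0_def)
  have W1: "Orig w \<in> W1" "Cp s0 w \<in> W1" "Nw s0 t0 \<in> W1" if "w \<in> W" for w
    using N1 S0 T0(1) that by (auto simp: G NEXT_def s0_def t0_def)
  have Nw1: "Nw s0 t0 \<in> W1"
    using N1 S0 T0(1) by (auto simp: G NEXT_def s0_def t0_def)
  have W2: "Orig w \<in> W2" "Cp s1 w \<in> W2" if "w \<in> W1" for w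
    using N2 S1 that unfolding N1 by (auto simp: NEXT_def s1_def)
  have F1: "(Orig x, Orig y) \<in> F1 \<longleftrightarrow> (x, y) \<in> F" "(Cp s0 x, Cp s0 y) \<in> F1 \<longleftrightarrow> (x, y) \<in> F"
    "(Nw s0 t0, Nw s0 t0) \<notin> F1" for x y
    using N1 S0 by (auto simp: G NEXT_def s0_def t0_def)
  have F1N: "(Nw s0 t0, Cp s0 x) \<in> F1 \<longleftrightarrow> x \<in> T0" "(Cp s0 x, Nw s0 t0) \<in> F1 \<longleftrightarrow> x \<in> T0" for x
    using N1 S0 T0(1) inj0 unfolding G NEXT_def s0_def t0_def by auto
  have F2: "(Orig x, Orig y) \<in> F2 \<longleftrightarrow> (x, y) \<in> F1" "(Cp s1 x, Cp s1 y) \<in> F2 \<longleftrightarrow> (x, y) \<in> F1"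
    "(Orig x, Cp s1 y) \<notin> F2" "(Cp s1 y, Orig x) \<notin> F2" for x y
    using N2 S1 unfolding N1 by (auto simp: NEXT_def s1_def)
  have TT1: "Orig ` S \<union> Cp (Abs_fset S) ` T \<in> TT1" if "S \<in> TT" "T \<in> TT" for S T
    using N1 that by (auto simp: G NEXT_def)
  have TT2: "Orig ` S \<union> Cp (Abs_fset S) ` T \<in> TT2" if "S \<in> TT1" "T \<in> TT1" for S T
    using N2 that unfolding N1 by (auto simp: NEXT_def)
  define g where "g x = (if x = r then Orig (Nw s0 t0) else if x \<in> V1 then Orig (Cp s0 (f1 x))
    else Cp s1 (Orig (f2 x)))" for x
  have g: "g r = Orig (Nw s0 t0)" "\<And>x. x \<in> V1 \<Longrightarrow> g x = Orig (Cp s0 (f1 x))"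
    "\<And>y. y \<in> V2 \<Longrightarrow> g y = Cp s1 (Orig (f2 y))"
    using disj by (auto simp: g_def)
  have "inj_on g (insert r (V1 \<union> V2))"
    using f1(1) f2(1) g unfolding inj_on_def by auto
  moreover have "g ` insert r (V1 \<union> V2) \<subseteq> W2"
    using f1(2) f2(2) g W1 W2 Nw1 by auto
  moreover have "\<forall>u\<in>insert r (V1 \<union> V2). \<forall>v\<in>insert r (V1 \<union> V2). (u, v) \<in> E \<longleftrightarrow> (g u, g v) \<in> F2"
    using g F1 F1N F2 N none T0(2) f1(3) f2(3) by auto
  moreover have "\<forall>C\<in>SS1 \<union> insert r ` SS2. \<exists>S'\<in>TT2. C = {v \<in> insert r (V1 \<union> V2). g v \<in> S'}"
  proof
    fix C assume "C \<in> SS1 \<union> insert r ` SS2"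
    thus "\<exists>S'\<in>TT2. C = {v \<in> insert r (V1 \<union> V2). g v \<in> S'}"
    proof
      assume "C \<in> SS1"
      then obtain T where T: "T \<in> TT" "C = {v \<in> V1. f1 v \<in> T}" using f1(4) by blast
      define U where "U = Orig ` S0 \<union> Cp s0 ` T"
      have U: "U \<in> TT1" using TT1[OF S0 T(1)] by (simp add: U_def s0_def)
      \<comment> \<open>As \<open>U\<close> differs from \<open>S1\<close>, the copy belonging to
        \<open>U\<close> is not the one holding \<open>V2\<close>, so \<open>U0\<close> can be
        arbitrary.\<close>
      have "Nw s0 t0 \<in> S1" "Nw s0 t0 \<notin> U" by (auto simp: S1_def U_def)
      hence "Abs_fset U \<noteq> s1" using inj1[OF U S1] by (auto simp: s1_def)
      hence "C = {v \<in> insert r (V1 \<union> V2). g v \<in> Orig ` U \<union> Cp (Abs_fset U) ` U0}"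
        using T(2) g disj by (auto simp: U_def)
      thus ?thesis using TT2[OF U U0] by blast
    next
      assume "C \<in> insert r ` SS2"
      then obtain C' where C': "C' \<in> SS2" "C = insert r C'" by blast
      then obtain T where T: "T \<in> TT" "C' = {v \<in> V2. f2 v \<in> T}" using f2(4) by blast
      define U where "U = Orig ` T \<union> Cp (Abs_fset T) ` T"
      have U: "U \<in> TT1" using TT1[OF T(1) T(1)] by (simp add: U_def)
      have "C = {v \<in> insert r (V1 \<union> V2). g v \<in> Orig ` S1 \<union> Cp s1 ` U}"
        using T(2) C'(2) g disj by (auto simp: U_def S1_def)
      thus ?thesis using TT2[OF S1 U] unfolding s1_def by blast
    qed
  qed
  ultimately show ?thesis
    unfolding N2 induced_sub_pair_def prod.case by (intro exI[of _ g] conjI)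
qed


text \<open>Asking for all branches at once makes the induction work: the neighbourhood
  \<open>Out r\<close> of the separating frame is then among the sets available for
  \<open>V1\<close>.\<close>

theorem (in weak_model) regular_constructible:
  assumes "\<And>v. v \<in> V \<Longrightarrow> regular A Out v"
  shows "\<exists>i. induced_sub_pair V E {C. C \<subseteq> V \<and> branch A C} ((NEXT ^^ i) G0)"
  using weak_model_axioms assms
proof (induction "card V" arbitrary: V A Out rk rule: less_induct)
  case less
  interpret weak_model V E A Out rk by (rule less.prems)
  have reg: "branch A (Out v \<union> A v)" "Out v \<inter> A v = {}" if "v \<in> V" for v
    using less.prems(2)[OF that] by (auto simp: regular_def)
  show ?case
  proof (cases "V = {}")
    case True
    have "induced_sub_pair V E {C. C \<subseteq> V \<and> branch A C} ((NEXT ^^ 0) G0)"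
      using True by (auto simp: induced_sub_pair_def G0_def)
    thus ?thesis ..
  next
    case False
    \<comment> \<open>The frame starting leftmost has no frame around it, so outermost frames
      exist.\<close>
    obtain m where m: "m \<in> V" "\<And>x. x \<in> V \<Longrightarrow> rk m \<le> rk x"
      using finite_has_max_image[OF fin False, of "\<lambda>x. - rk x"] by auto
    have "A m = {}" using A_rk[OF m(1)] A_sub[OF m(1)] m(2) by (metis ex_in_conv not_less subsetD)
    hence ne: "{x \<in> V. A x = {}} \<noteq> {}" using m by blast
    have "finite {x \<in> V. A x = {}}" using fin by simp
    then obtain r where "r \<in> {x \<in> V. A x = {}}" "\<And>x. x \<in> {x \<in> V. A x = {}} \<Longrightarrow> rk x \<le> rk r"
      using finite_has_max_image[OF _ ne] by blast
    hence r: "r \<in> V" "A r = {}" and r_max: "\<And>x. x \<in> V \<Longrightarrow> A x = {} \<Longrightarrow> rk x \<le> rk r" by auto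
    define V2 where "V2 = {x \<in> V. r \<in> A x}"
    define V1 where "V1 = V - insert r V2"
    define A2 where "A2 x = A x - {r}" for x
    have V12: "insert r (V1 \<union> V2) = V" "V1 \<inter> V2 = {}" "r \<notin> V1" "r \<notin> V2"
      using r by (auto simp: V1_def V2_def)
    have in1: "x \<in> V \<and> x \<noteq> r \<and> r \<notin> A x" if "x \<in> V1" for x using that by (auto simp: V1_def V2_def)
    have in2: "x \<in> V \<and> r \<in> A x" if "x \<in> V2" for x using that by (auto simp: V2_def)
    \<comment> \<open>A frame entering \<open>r\<close> would, by regularity, have nothing around
      it, and so be an outermost frame starting to the right of \<open>r\<close>.\<close>
    have r_out: "r \<notin> Out x" if x: "x \<in> V" for x
    proof
      assume rx: "r \<in> Out x"
      have "e = r \<or> r \<in> A e" if "e \<in> A x" for e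
        using reg(1)[OF x] rx r(2) that unfolding branch_def by blast
      hence "A x = {}" using reg(2)[OF x] rx A_trans[OF x] by blast
      thus False using r_max[OF x] Out_rk[OF x rx] by simp
    qed
    have A1: "A x \<subseteq> V1" if "x \<in> V1" for x
      using in1[OF that] A_sub[of x] A_trans[of x] by (auto simp: V1_def V2_def)
    \<comment> \<open>Entering a frame inside \<open>r\<close> from outside would, by regularity,
      mean entering \<open>r\<close> or lying inside it.\<close>
    have O1: "Out x \<subseteq> V1" if "x \<in> V1 \<or> x = r" for x
    proof -
      have x: "x \<in> V" "r \<notin> A x" using that in1 r by auto
      have "A y \<subseteq> Out x \<union> A x" if "y \<in> Out x" for y using reg(1)[OF x(1)] that by (auto simp: branch_def)
      thus ?thesis using x Out_sub[OF x(1)] r_out[OF x(1)] by (auto simp: V1_def V2_def)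
    qed
    have O2: "Out x \<subseteq> V2" if "x \<in> V2" for x
    proof
      fix y assume y: "y \<in> Out x"
      have x: "x \<in> V" "r \<in> A x" using in2 that by auto
      have "y = r \<or> y \<in> A r \<or> r \<in> A y" using reg(1)[OF x(1)] y x(2) by (auto simp: branch_def)
      thus "y \<in> V2" using r(2) r_out[OF x(1)] y Out_sub[OF x(1)] by (auto simp: V2_def)
    qed
    have A2: "A2 x \<subseteq> V2" if "x \<in> V2" for x
    proof
      fix y assume "y \<in> A2 x"
      hence y: "y \<in> A x" "y \<noteq> r" by (auto simp: A2_def)
      have "r \<in> A y" using A_chain[of x y r] y in2[OF that] r(2) by auto
      thus "y \<in> V2" using y A_sub in2[OF that] by (auto simp: V2_def)
    qed
    have w1: "weak_model V1 E A Out rk"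
    proof
      show "finite V1" using fin by (simp add: V1_def)
      fix v assume "v \<in> V1"
      note v = this in1[OF this, THEN conjunct1]
      show "A v \<subseteq> V1" "Out v \<subseteq> V1" using A1 O1 v by auto
      show "regular A Out v \<or> (\<exists>u. irregular A Out v u)" using weak v by blast
      fix a
      show "rk a < rk v" if "a \<in> A v" using A_rk v that by blast
      show "rk a < rk v" if "a \<in> Out v" using Out_rk v that by blast
      show "A a \<subseteq> A v" if "a \<in> A v" using A_trans v that by blast
      show "a = b \<or> a \<in> A b \<or> b \<in> A a" if "a \<in> A v" "b \<in> A v" for b using A_chain v that by blast
      show "(v, y) \<in> E \<longleftrightarrow> v \<in> Out y \<or> y \<in> Out v" if "y \<in> V1" for y
        using E_iff v in1[OF that] by blast
    qed
    have reg2: "regular A2 Out v" if "v \<in> V2" for v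
    proof -
      have v: "v \<in> V" "r \<in> A v" using in2 that by auto
      have "Out v \<union> A2 v = Out v \<union> A v - {r}" using r_out[OF v(1)] by (auto simp: A2_def)
      hence "branch A2 (Out v \<union> A2 v)" using reg(1)[OF v(1)] unfolding branch_def A2_def by auto
      thus ?thesis using reg(2)[OF v(1)] by (auto simp: regular_def A2_def)
    qed
    have w2: "weak_model V2 E A2 Out rk"
    proof
      show "finite V2" using fin by (simp add: V2_def)
      fix v assume "v \<in> V2"
      note v = this in2[OF this, THEN conjunct1]
      show "A2 v \<subseteq> V2" "Out v \<subseteq> V2" using A2 O2 v by auto
      show "regular A2 Out v \<or> (\<exists>u. irregular A2 Out v u)" using reg2 v by blast
      fix a
      show "rk a < rk v" if "a \<in> A2 v" using A_rk v that by (auto simp: A2_def)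
      show "rk a < rk v" if "a \<in> Out v" using Out_rk v that by blast
      show "A2 a \<subseteq> A2 v" if "a \<in> A2 v" using A_trans[OF v(2), of a] that by (auto simp: A2_def)
      show "a = b \<or> a \<in> A2 b \<or> b \<in> A2 a" if "a \<in> A2 v" "b \<in> A2 v" for b
        using A_chain[OF v(2), of a b] that by (auto simp: A2_def)
      show "(v, y) \<in> E \<longleftrightarrow> v \<in> Out y \<or> y \<in> Out v" if "y \<in> V2" for y
        using E_iff v in2[OF that] by blast
    qed
    have card: "card V1 < card V" "card V2 < card V"
      using fin r V12 by (auto intro!: psubset_card_mono)
    obtain i1 where i1: "induced_sub_pair V1 E {C. C \<subseteq> V1 \<and> branch A C} ((NEXT ^^ i1) G0)"
      using less.hyps[OF card(1) w1] less.prems(2) in1 by blast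
    obtain i2 where i2: "induced_sub_pair V2 E {C. C \<subseteq> V2 \<and> branch A2 C} ((NEXT ^^ i2) G0)"
      using less.hyps[OF card(2) w2] reg2 by blast
    have i: "induced_sub_pair V1 E {C. C \<subseteq> V1 \<and> branch A C} ((NEXT ^^ max i1 i2) G0)"
      "induced_sub_pair V2 E {C. C \<subseteq> V2 \<and> branch A2 C} ((NEXT ^^ max i1 i2) G0)"
      using induced_sub_pair_NEXT_le[OF i1] induced_sub_pair_NEXT_le[OF i2] by simp_all
    have big: "induced_sub_pair (insert r (V1 \<union> V2)) E
        ({C. C \<subseteq> V1 \<and> branch A C} \<union> insert r ` {C. C \<subseteq> V2 \<and> branch A2 C})
        (NEXT (NEXT ((NEXT ^^ max i1 i2) G0)))"
    proof (rule induced_sub_pair_attach[OF wf_pair_NEXT_pow i V12(2-4)])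
      show "Out r \<in> {C. C \<subseteq> V1 \<and> branch A C}" using O1[of r] reg(1)[OF r(1)] r(2) by simp
      show "(r, x) \<in> E \<longleftrightarrow> x \<in> Out r" "(x, r) \<in> E \<longleftrightarrow> x \<in> Out r" if "x \<in> V1" for x
        using E_iff[of r x] E_iff[of x r] r(1) in1[OF that] r_out[of x] by auto
      show "(r, r) \<notin> E" using E_iff r_out r(1) by blast
      show "(r, y) \<notin> E" "(y, r) \<notin> E" if "y \<in> V2" for y
        using E_iff[of r y] E_iff[of y r] r(1) in2[OF that] r_out[of y] O1[of r] that V12(2) by auto
      show "(x, y) \<notin> E" "(y, x) \<notin> E" if "x \<in> V1" "y \<in> V2" for x y
        using E_iff[of x y] E_iff[of y x] in1[OF that(1)] in2[OF that(2)] O1[of x] O2[of y] that V12(2) by auto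
    qed
    \<comment> \<open>Since \<open>r\<close> is outermost, a branch through \<open>r\<close> lies
      inside \<open>r\<close> apart from \<open>r\<close> itself, and a branch avoiding
      \<open>r\<close> contains nothing inside \<open>r\<close>.\<close>
    have sub: "{C. C \<subseteq> V \<and> branch A C} \<subseteq>
        {C. C \<subseteq> V1 \<and> branch A C} \<union> insert r ` {C. C \<subseteq> V2 \<and> branch A2 C}"
    proof
      fix C assume "C \<in> {C. C \<subseteq> V \<and> branch A C}"
      hence C: "C \<subseteq> V" "branch A C" by auto
      show "C \<in> {C. C \<subseteq> V1 \<and> branch A C} \<union> insert r ` {C. C \<subseteq> V2 \<and> branch A2 C}"
      proof (cases "r \<in> C")
        case False
        hence "C \<subseteq> V1" using C by (auto simp: V1_def V2_def branch_def)
        thus ?thesis using C by blast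
      next
        case True
        have "r \<in> A y" if "y \<in> C - {r}" for y
          using C(2) True that r(2) unfolding branch_def by blast
        hence "C - {r} \<subseteq> V2" using C(1) by (auto simp: V2_def)
        moreover have "branch A2 (C - {r})" using C(2) unfolding branch_def A2_def by auto
        moreover have "C = insert r (C - {r})" using True by blast
        ultimately show ?thesis by blast
      qed
    qed
    have "induced_sub_pair V E {C. C \<subseteq> V \<and> branch A C} ((NEXT ^^ Suc (Suc (max i1 i2))) G0)"
      using induced_sub_pair_mono[OF big sub] unfolding V12(1) by simp
    thus ?thesis ..
  qed
qed

theorem theoremB5:
  fixes V :: "'a set" and E :: "('a \<times> 'a) set"
  assumes "finite V" and "graph V E"
    and "restricted_frame_graph V E"
    and "ge2_subdivision V E"
  shows "\<exists>SS. (\<forall>S\<in>SS. stable_set V E S) \<and> constructible V E SS"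
proof (rule ge2_subdivision_sparse[OF assms(2,4)])
  fix B assume B: "\<And>b c. b \<in> B \<Longrightarrow> c \<in> B \<Longrightarrow> (b, c) \<notin> E"
    "\<And>x b c. x \<in> V \<Longrightarrow> b \<in> B \<Longrightarrow> c \<in> B \<Longrightarrow> (x, b) \<in> E \<Longrightarrow> (x, c) \<in> E \<Longrightarrow> b = c"
    "\<And>x b c d. x \<in> V - B \<Longrightarrow> (x, b) \<in> E \<Longrightarrow> (x, c) \<in> E \<Longrightarrow> (x, d) \<in> E \<Longrightarrow> b \<noteq> c \<Longrightarrow> d = b \<or> d = c"
    and C34: "\<And>a b c. (a, b) \<in> E \<Longrightarrow> (b, c) \<in> E \<Longrightarrow> (c, a) \<in> E \<Longrightarrow> False"
    "\<And>a b c d. (a, b) \<in> E \<Longrightarrow> (b, c) \<in> E \<Longrightarrow> (c, d) \<in> E \<Longrightarrow> (d, a) \<in> E \<Longrightarrow> a \<noteq> c \<Longrightarrow> b \<noteq> d \<Longrightarrow> False"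
  have "\<exists>A Out rk. weak_model V E A Out rk"
    by (rule frames_weak_model[OF assms(1-3)]) (fact C34)+
  then obtain A0 Out0 rk0 where m0: "weak_model V E A0 Out0 rk0" by blast
  have "\<exists>A Out rk. weak_model V E A Out rk \<and> (\<forall>v\<in>V. regular A Out v)"
    by (rule weak_model.all_regular[OF m0, of B]) (fact B)+
  then obtain A Out rk where m: "weak_model V E A Out rk" and reg: "\<forall>v\<in>V. regular A Out v"
    by blast
  let ?SS = "{C. C \<subseteq> V \<and> branch A C}"
  have "constructible V E ?SS"
    using weak_model.regular_constructible[OF m] reg unfolding constructible_def by blast
  moreover have "\<forall>S\<in>?SS. stable_set V E S" using weak_model.branch_stable[OF m] by blast
  ultimately show ?thesis by blast
qed

end
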